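(* Let $d,e,u,v,q$ be complex parameters (generic, so no denominator vanishes). Let $K_5(n):=K(q,q^{-n},q^{1-n},d,e,u,v,q^2)$ and put \[ E_r:=\frac{(d,e,q^2u,q^2v,q^3/u,q^3/v;q^2)_r}{(q^3/d,q^3/e,u,v,q/u,q/v;q^2)_r\,(de)^r},\qquad F_r:=\frac{(d/q,e/q,qu,qv,q^2/u,q^2/v;q^2)_r}{(q^2/d,q^2/e,u/q,v/q,1/u,1/v;q^2)_r\,(de)^r}. \] (i) The sequences with $\alpha_0=\beta_0=1$ and \[ \alpha_{2r}=\frac{1-q^{4r+1}}{1-q}q^{2r^2-2r}E_r\ (r\ge0),\quad \alpha_{2r-1}=-\frac{1-q^{4r-1}}{1-q}q^{2r^2-4r+1}F_r\ (r\ge1),\quad \beta_n=K_5(n)\frac{(q^3/de;q^2)_n}{(q^2;q^2)_n(q^2/d,q^2/e;q)_n}, \] form a Bailey pair relative to $a=q$. (ii) The sequences with $\alpha_0=\beta_0=1$ and, for $r\ge1$, \[ \alpha_{2r}=q^{2r^2-2r}E_r+q^{2r^2}F_r,\quad \alpha_{2r-1}=-q^{2r^2-2r+1}E_{r-1}-q^{2r^2-4r+1}F_r,\quad \beta_n=K_5(n)\frac{(q^3/de;q^2)_n}{(q^2;q^2)_n(q^2/d,q^2/e;q)_n}, \] form a Bailey pair relative to $a=1$. (iii) The sequences with $\alpha_0=\beta_0=1$ and, for $r\ge1$, \[ \alpha_{2r}=q^{2r^2}E_r+q^{2r^2-2r}F_r,\quad \alpha_{2r-1}=-q^{2r^2-4r+2}E_{r-1}-q^{2r^2-2r}F_r,\quad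 \beta_n=K_5(n)\frac{q^n(q^3/de;q^2)_n}{(q^2;q^2)_n(q^2/d,q^2/e;q)_n}, \] form a Bailey pair relative to $a=1$.
   Context: Notation: $(x;q)_n=\prod_{k=0}^{n-1}(1-xq^k)$ and $(x_1,\dots,x_k;q)_n=(x_1;q)_n\cdots(x_k;q)_n$. A pair of sequences $(\alpha_n)_{n\ge0},(\beta_n)_{n\ge0}$ is a Bailey pair relative to $a$ if $\alpha_0=1$ and $\beta_n=\sum_{j=0}^{n}\frac{\alpha_j}{(q;q)_{n-j}(aq;q)_{n+j}}$ for all $n\ge0$. The function $K$: for complex $a,b,c,d,e,u,v$ and a base $p$, let $\sigma_1,\dots,\sigma_4$ be the elementary symmetric functions of $b,c,d,e$ and \[ K(a,b,c,d,e,u,v,p):=\frac{uv(\sigma_3-a\sigma_1)(p\sigma_3-a\sigma_1)a^2+(1-p)uv(a^2-\sigma_4)(a^2-\sigma_2a+\sigma_4)a+(u+v)(a+uv)(\sigma_3-a\sigma_1)(a^2-p\sigma_4)a+(u^2+a)(v^2+a)(a^2-\sigma_4)(a^2-p\sigma_4)}{(a^2-bcde)(a^2-bcde\,p)(1-u)(a-u)(1-v)(a-v)}. \] *)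

theory Defs
  imports Complex_Main
begin

definition qpoch :: "complex \<Rightarrow> complex \<Rightarrow> nat \<Rightarrow> complex" where
  "qpoch x q n = (\<Prod>k<n. 1 - x * q ^ k)"

text \<open>The multi-parameter symbol $(x_1,\dots,x_k;q)_n$.\<close>

definition qpochs :: "complex list \<Rightarrow> complex \<Rightarrow> nat \<Rightarrow> complex" where
  "qpochs xs q n = (\<Prod>x\<leftarrow>xs. qpoch x q n)"

text \<open>The first argument is the base \<open>q\<close>; the pair is relative to the second argument \<open>a\<close>.\<close>

definition bailey_pair ::
  "complex \<Rightarrow> complex \<Rightarrow> (nat \<Rightarrow> complex) \<Rightarrow> (nat \<Rightarrow> complex) \<Rightarrow> bool" where
  "bailey_pair q a \<alpha> \<beta> \<longleftrightarrow>
     \<alpha> 0 = 1 \<and>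
     (\<forall>n. \<beta> n = (\<Sum>j=0..n. \<alpha> j / (qpoch q q (n - j) * qpoch (a * q) q (n + j))))"

text \<open>Numerator and denominator of \<open>K\<close> are named separately so that the non-vanishing of the
  denominator can be stated as a genericity hypothesis; \<open>s1, \<dots>, s4\<close> are the elementary
  symmetric functions of \<open>b, c, d, e\<close>.\<close>

definition K_num ::
  "complex \<Rightarrow> complex \<Rightarrow> complex \<Rightarrow> complex \<Rightarrow> complex \<Rightarrow> complex \<Rightarrow> complex \<Rightarrow> complex \<Rightarrow> complex" where
  "K_num a b c d e u v p =
    (let s1 = b + c + d + e;
         s2 = b*c + b*d + b*e + c*d + c*e + d*e;
         s3 = b*c*d + b*c*e + b*d*e + c*d*e;
         s4 = b*c*d*e
     in u * v * (s3 - a * s1) * (p * s3 - a * s1) * a\<^sup>2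
      + (1 - p) * u * v * (a\<^sup>2 - s4) * (a\<^sup>2 - s2 * a + s4) * a
      + (u + v) * (a + u * v) * (s3 - a * s1) * (a\<^sup>2 - p * s4) * a
      + (u\<^sup>2 + a) * (v\<^sup>2 + a) * (a\<^sup>2 - s4) * (a\<^sup>2 - p * s4))"

definition K_den ::
  "complex \<Rightarrow> complex \<Rightarrow> complex \<Rightarrow> complex \<Rightarrow> complex \<Rightarrow> complex \<Rightarrow> complex \<Rightarrow> complex \<Rightarrow> complex" where
  "K_den a b c d e u v p =
     (a\<^sup>2 - b*c*d*e) * (a\<^sup>2 - b*c*d*e*p) * (1 - u) * (a - u) * (1 - v) * (a - v)"

definition K ::
  "complex \<Rightarrow> complex \<Rightarrow> complex \<Rightarrow> complex \<Rightarrow> complex \<Rightarrow> complex \<Rightarrow> complex \<Rightarrow> complex \<Rightarrow> complex" where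
  "K a b c d e u v p = K_num a b c d e u v p / K_den a b c d e u v p"

definition K5 :: "complex \<Rightarrow> complex \<Rightarrow> complex \<Rightarrow> complex \<Rightarrow> complex \<Rightarrow> nat \<Rightarrow> complex" where
  "K5 d e u v q n = K q (q powi (- int n)) (q powi (1 - int n)) d e u v (q\<^sup>2)"

definition E_seq :: "complex \<Rightarrow> complex \<Rightarrow> complex \<Rightarrow> complex \<Rightarrow> complex \<Rightarrow> nat \<Rightarrow> complex" where
  "E_seq d e u v q r =
     qpochs [d, e, q^2 * u, q^2 * v, q^3 / u, q^3 / v] (q\<^sup>2) r /
     (qpochs [q^3 / d, q^3 / e, u, v, q / u, q / v] (q\<^sup>2) r * (d * e) ^ r)"

definition F_seq :: "complex \<Rightarrow> complex \<Rightarrow> complex \<Rightarrow> complex \<Rightarrow> complex \<Rightarrow> nat \<Rightarrow> complex" where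
  "F_seq d e u v q r =
     qpochs [d / q, e / q, q * u, q * v, q^2 / u, q^2 / v] (q\<^sup>2) r /
     (qpochs [q^2 / d, q^2 / e, u / q, v / q, 1 / u, 1 / v] (q\<^sup>2) r * (d * e) ^ r)"

end

theory Submission
  imports Defs
begin

text \<open>
  Parts (ii) and (iii) follow from (i) by two contiguity relations of the kernel
  $1/((q;q)_{n-j}(q;q)_{n+j})$. In (i), put $y_j = q^{-j} + q^{j+1}$. The parameters $u$ and $v$
  enter \<open>\<alpha>\<^sub>j\<close> only through the factors $u + q/u - y_j$ and $v + q/v - y_j$, so the sum is a
  combination of the moments $M_0, M_1, M_2$, where $M_k(n)$ inserts $y_j^k$ in the sum without
  $u$ and $v$. Even and odd $j$ are the two halves $r \ge 0$ and $r < 0$ of a terminating bilateral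
  very-well-poised series, for which one linear combination of $1$ and $y_j$ telescopes: this gives
  $M_1/M_0$.
  The kernel at $n$ is $1 + q^{2n+3} - q^{n+1} y_j$ times the kernel at $n+1$, whence
  $M_k(n) = (1 + q^{2n+3}) M_k(n+1) - q^{n+1} M_{k+1}(n+1)$. For $k = 0$ this is a first-order
  recurrence for $M_0$, and for $k = 1$ it yields $M_2$; the function $K$ collects the resulting
  ratios.
\<close>

section \<open>Elementary rules for q-shifted factorials\<close>

lemma qpoch_0 [simp]: "qpoch x q 0 = 1"
  by (simp add: qpoch_def)

lemma qpoch_Suc: "qpoch x q (Suc n) = qpoch x q n * (1 - x * q ^ n)"
  by (simp add: qpoch_def)

lemma qpoch_Suc_shift: "qpoch x q (Suc n) = (1 - x) * qpoch (x * q) q n"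
  unfolding qpoch_def by (subst prod.lessThan_Suc_shift) (simp add: mult.assoc)

lemma qpoch_shift: "qpoch (x * q) q n * (1 - x) = qpoch x q n * (1 - x * q ^ n)"
  by (metis mult.commute qpoch_Suc qpoch_Suc_shift)

lemma qpoch_nonzero_factor:
  assumes "\<And>n. qpoch x q n \<noteq> 0"
  shows "x * q ^ n \<noteq> 1"
  using assms[of "Suc n"] by (auto simp: qpoch_Suc)

section \<open>Contiguity of the Bailey kernel\<close>

text \<open>The value m = 0 belongs to a = 1 and m = 1 to a = q, the latter up to the factor 1 - q.
  The value 0 beyond n guards the truncated difference and lets sums run past n.\<close>

definition bailey_kernel :: "nat \<Rightarrow> complex \<Rightarrow> nat \<Rightarrow> nat \<Rightarrow> complex" where
  "bailey_kernel m q n j =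
     (if j \<le> n then 1 / (qpoch q q (n - j) * qpoch q q (n + j + m)) else 0)"

text \<open>The expression is invariant under j -> -1 - j, the symmetry that exchanges the even and
  the odd indices of the bilateral series.\<close>

definition node :: "complex \<Rightarrow> nat \<Rightarrow> complex" where
  "node q j = 1 / q ^ j + q ^ (j + 1)"

locale nonroot =
  fixes q :: complex
  assumes q_nonzero: "q \<noteq> 0"
    and q_not_root: "\<And>n::nat. n \<ge> 1 \<Longrightarrow> q ^ n \<noteq> 1"
begin

lemma qpoch_q_nonzero [simp]: "qpoch q q n \<noteq> 0"
proof -
  have "q * q ^ k \<noteq> 1" for k
    using q_not_root[of "Suc k"] by simp
  then show ?thesis by (auto simp: qpoch_def)
qed

lemma one_minus_power_nonzero: "n \<ge> 1 \<Longrightarrow> 1 - q ^ n \<noteq> 0"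
  using q_not_root[of n] by simp

text \<open>The ratio of neighbouring kernels is (1 - q^(n-j)) / (1 - q^(n+j+m+1)); the factor q^j
  avoids negative exponents. At j = n both sides vanish, so no restriction on j is needed.\<close>

lemma bailey_kernel_Suc_right:
  "bailey_kernel m q n (Suc j) * ((1 - q ^ (n + j + m + 1)) * q ^ j)
     = bailey_kernel m q n j * (q ^ j - q ^ n)"
proof (cases "Suc j \<le> n")
  case True
  then obtain k where n: "n = Suc (j + k)"
    by (metis add_Suc le_iff_add)
  have nz: "1 - q * q ^ k \<noteq> 0" "1 - q * q ^ (n + j + m) \<noteq> 0"
    using one_minus_power_nonzero[of "Suc k"] one_minus_power_nonzero[of "Suc (n + j + m)"] by auto
  have a: "bailey_kernel m q n j = 1 / (qpoch q q k * (1 - q * q ^ k) * qpoch q q (n + j + m))"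
    using n by (simp add: bailey_kernel_def qpoch_Suc Suc_diff_le)
  have b: "bailey_kernel m q n (Suc j)
      = 1 / (qpoch q q k * (qpoch q q (n + j + m) * (1 - q * q ^ (n + j + m))))"
    using n by (simp add: bailey_kernel_def qpoch_Suc)
  have c: "q ^ j - q ^ n = q ^ j * (1 - q * q ^ k)"
    by (simp add: n power_add algebra_simps)
  show ?thesis
    unfolding a b c using nz by simp
next
  case False
  then show ?thesis by (cases "j = n") (auto simp: bailey_kernel_def)
qed

text \<open>The bracket factors as (1 - q^(n+1-j)) (1 - q^(n+j+2)), the two factors by which the
  denominators at n and n + 1 differ. At j = n + 1 the first one is 0, which agrees with the kernel
  at n.\<close>

lemma bailey_kernel_Suc_left:
  "bailey_kernel 1 q n j
     = bailey_kernel 1 q (Suc n) j * (1 + q ^ (2 * n + 3) - q ^ (n + 1) * node q j)"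
proof -
  consider (le) "j \<le> n" | (eq) "j = Suc n" | (gt) "j > Suc n" by linarith
  then show ?thesis
  proof cases
    case le
    then obtain k where n: "n = j + k" using le_Suc_ex by blast
    have nz: "1 - q * q ^ k \<noteq> 0" "1 - q * q ^ (n + j + 1) \<noteq> 0"
      using one_minus_power_nonzero[of "Suc k"] one_minus_power_nonzero[of "Suc (n + j + 1)"]
      by auto
    have a: "bailey_kernel 1 q n j = 1 / (qpoch q q k * qpoch q q (n + j + 1))"
      using n by (simp add: bailey_kernel_def)
    have b: "bailey_kernel 1 q (Suc n) j
        = 1 / (qpoch q q k * (1 - q * q ^ k) * (qpoch q q (n + j + 1) * (1 - q * q ^ (n + j + 1))))"
      using n by (simp add: bailey_kernel_def qpoch_Suc Suc_diff_le)
    have c: "1 + q ^ (2 * n + 3) - q ^ (n + 1) * node q j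
        = (1 - q * q ^ k) * (1 - q * q ^ (n + j + 1))"
      using q_nonzero
      by (simp add: n node_def power_add power_mult power2_eq_square power3_eq_cube field_simps)
    show ?thesis
      unfolding a b c using nz by simp
  next
    case eq
    have "1 + q ^ (2 * n + 3) - q ^ (n + 1) * node q j = 0"
      using q_nonzero
      by (simp add: eq node_def power_add power_mult power2_eq_square power3_eq_cube field_simps)
    then show ?thesis by (simp add: eq bailey_kernel_def)
  qed (simp add: bailey_kernel_def)
qed

text \<open>With k the kernel for m = 1 at j, the kernels for m = 0 at j and j + 1 are k (1 -
  q^(n+j+1)) and k (1 - q^(n-j)). The first relation eliminates q^n from these two, the second
  eliminates the constant 1.\<close>

lemma bailey_kernel_contiguous:
  "(1 - q ^ (2 * j + 1)) * bailey_kernel 1 q n j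
     = bailey_kernel 0 q n j - q ^ (2 * j + 1) * bailey_kernel 0 q n (Suc j)"
  "q ^ n * (1 - q ^ (2 * j + 1)) * bailey_kernel 1 q n j
     = q ^ j * (bailey_kernel 0 q n j - bailey_kernel 0 q n (Suc j))"
proof -
  have nz: "1 - q ^ (n + j + 1) \<noteq> 0"
    using one_minus_power_nonzero[of "n + j + 1"] by simp
  have one: "bailey_kernel 0 q n j = bailey_kernel 1 q n j * (1 - q ^ (n + j + 1))"
    using nz by (simp add: bailey_kernel_def qpoch_Suc)
  have "bailey_kernel 0 q n (Suc j) * q ^ j * (1 - q ^ (n + j + 1))
      = bailey_kernel 1 q n j * (q ^ j - q ^ n) * (1 - q ^ (n + j + 1))"
    using bailey_kernel_Suc_right[of 0 n j] one by (simp add: mult_ac)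
  then have two: "bailey_kernel 0 q n (Suc j) * q ^ j = bailey_kernel 1 q n j * (q ^ j - q ^ n)"
    using nz by simp
  have "q ^ (2 * j + 1) * bailey_kernel 0 q n (Suc j)
      = q ^ (j + 1) * (bailey_kernel 0 q n (Suc j) * q ^ j)"
    by (simp add: power_add mult_2)
  also have "\<dots> = q ^ (j + 1) * (bailey_kernel 1 q n j * (q ^ j - q ^ n))"
    by (simp only: two)
  finally have three: "q ^ (2 * j + 1) * bailey_kernel 0 q n (Suc j)
      = q ^ (j + 1) * (bailey_kernel 1 q n j * (q ^ j - q ^ n))" .
  have sq: "q ^ (2 * j + 1) = q * (q ^ j * q ^ j)"
    by (simp add: power_add mult_2)
  show "(1 - q ^ (2 * j + 1)) * bailey_kernel 1 q n j
     = bailey_kernel 0 q n j - q ^ (2 * j + 1) * bailey_kernel 0 q n (Suc j)"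
    unfolding three one unfolding sq by (simp add: power_add algebra_simps)
  have "q ^ j * (bailey_kernel 0 q n j - bailey_kernel 0 q n (Suc j))
      = q ^ j * bailey_kernel 0 q n j - bailey_kernel 0 q n (Suc j) * q ^ j"
    by (simp add: algebra_simps)
  also have "\<dots> = q ^ n * (1 - q ^ (2 * j + 1)) * bailey_kernel 1 q n j"
    unfolding two one unfolding sq by (simp add: power_add algebra_simps)
  finally show "q ^ n * (1 - q ^ (2 * j + 1)) * bailey_kernel 1 q n j
     = q ^ j * (bailey_kernel 0 q n j - bailey_kernel 0 q n (Suc j))"
    by simp
qed

section \<open>Bailey pairs through the kernel, and the passage from a = q to a = 1\<close>

lemma bailey_pair_q_iff:
  "bailey_pair q q \<alpha> \<beta> \<longleftrightarrow>
     \<alpha> 0 = 1 \<and> (\<forall>n. \<beta> n = (\<Sum>j\<le>n. (1 - q) * \<alpha> j * bailey_kernel 1 q n j))"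
proof -
  have "\<alpha> j / (qpoch q q (n - j) * qpoch (q * q) q (n + j))
      = (1 - q) * \<alpha> j * bailey_kernel 1 q n j" if "j \<le> n" for n j
  proof -
    have "qpoch q q (n + j + 1) = (1 - q) * qpoch (q * q) q (n + j)"
      using qpoch_Suc_shift[of q q "n + j"] by simp
    then show ?thesis
      using that q_not_root[of 1] by (simp add: bailey_kernel_def)
  qed
  then show ?thesis
    by (simp add: bailey_pair_def atLeast0AtMost)
qed

lemma bailey_pair_one_iff:
  "bailey_pair q 1 \<alpha> \<beta> \<longleftrightarrow>
     \<alpha> 0 = 1 \<and> (\<forall>n. \<beta> n = (\<Sum>j\<le>n. \<alpha> j * bailey_kernel 0 q n j))"
  by (simp add: bailey_pair_def atLeast0AtMost bailey_kernel_def)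

text \<open>The shifted sum acquires a term at n + 1, where the kernel is 0. This is the index shift
  in the summation by parts below.\<close>

lemma sum_bailey_kernel_shift:
  "(\<Sum>j\<le>n. f j * bailey_kernel 0 q n (Suc j))
     = (\<Sum>j\<le>n. (if j = 0 then 0 else f (j - 1)) * bailey_kernel 0 q n j)"
proof -
  have "(\<Sum>j\<le>n. f j * bailey_kernel 0 q n (Suc j))
      = (\<Sum>j\<le>Suc n. (if j = 0 then 0 else f (j - 1)) * bailey_kernel 0 q n j)"
    by (subst sum.atMost_Suc_shift) simp
  then show ?thesis by (simp add: bailey_kernel_def)
qed

text \<open>The first contiguity relation absorbs the factor 1 - q^(2j+1), and shifting the second
  sum collects the coefficient of each kernel. The value 1 at index 0 agrees because the given pair
  forces A 0 = 1.\<close>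

lemma bailey_pair_q_to_one:
  assumes pair: "bailey_pair q q \<alpha> \<beta>"
    and A: "\<And>j. \<alpha> j = (1 - q ^ (2 * j + 1)) / (1 - q) * A j"
    and \<alpha>': "\<alpha>' 0 = 1" "\<And>j. \<alpha>' (Suc j) = A (Suc j) - q ^ (2 * j + 1) * A j"
  shows "bailey_pair q 1 \<alpha>' \<beta>"
proof -
  have A0: "A 0 = 1"
    using pair A[of 0] q_not_root[of 1] by (simp add: bailey_pair_q_iff)
  have "\<beta> n = (\<Sum>j\<le>n. \<alpha>' j * bailey_kernel 0 q n j)" for n
  proof -
    have "\<beta> n = (\<Sum>j\<le>n. A j * ((1 - q ^ (2 * j + 1)) * bailey_kernel 1 q n j))"
      using pair q_not_root[of 1] by (simp add: bailey_pair_q_iff A mult_ac)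
    also have "\<dots> = (\<Sum>j\<le>n. A j * bailey_kernel 0 q n j)
        - (\<Sum>j\<le>n. q ^ (2 * j + 1) * A j * bailey_kernel 0 q n (Suc j))"
      unfolding bailey_kernel_contiguous
      by (simp add: sum_subtractf[symmetric] algebra_simps)
    also have "\<dots> = (\<Sum>j\<le>n. \<alpha>' j * bailey_kernel 0 q n j)"
      unfolding sum_bailey_kernel_shift sum_subtractf[symmetric]
    proof (rule sum.cong)
      fix j show "A j * bailey_kernel 0 q n j
          - (if j = 0 then 0 else q ^ (2 * (j - 1) + 1) * A (j - 1)) * bailey_kernel 0 q n j
          = \<alpha>' j * bailey_kernel 0 q n j"
        by (cases j) (simp_all add: \<alpha>' A0 algebra_simps)
    qed simp
    finally show ?thesis .
  qed
  then show ?thesis by (simp add: bailey_pair_one_iff \<alpha>')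
qed

text \<open>The same summation by parts with the second contiguity relation, whose factor q^n passes
  into \<open>\<beta>\<close>.\<close>

lemma bailey_pair_q_to_one_power:
  assumes pair: "bailey_pair q q \<alpha> \<beta>"
    and A: "\<And>j. \<alpha> j = (1 - q ^ (2 * j + 1)) / (1 - q) * A j"
    and \<alpha>': "\<alpha>' 0 = 1" "\<And>j. \<alpha>' (Suc j) = q ^ Suc j * A (Suc j) - q ^ j * A j"
  shows "bailey_pair q 1 \<alpha>' (\<lambda>n. q ^ n * \<beta> n)"
proof -
  have A0: "A 0 = 1"
    using pair A[of 0] q_not_root[of 1] by (simp add: bailey_pair_q_iff)
  have "q ^ n * \<beta> n = (\<Sum>j\<le>n. \<alpha>' j * bailey_kernel 0 q n j)" for n
  proof -
    have "q ^ n * \<beta> n = (\<Sum>j\<le>n. A j * (q ^ n * (1 - q ^ (2 * j + 1)) * bailey_kernel 1 q n j))"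
      using pair q_not_root[of 1] by (simp add: bailey_pair_q_iff A sum_distrib_left mult_ac)
    also have "\<dots> = (\<Sum>j\<le>n. q ^ j * A j * bailey_kernel 0 q n j)
        - (\<Sum>j\<le>n. q ^ j * A j * bailey_kernel 0 q n (Suc j))"
      unfolding bailey_kernel_contiguous
      by (simp add: sum_subtractf[symmetric] algebra_simps)
    also have "\<dots> = (\<Sum>j\<le>n. \<alpha>' j * bailey_kernel 0 q n j)"
      unfolding sum_bailey_kernel_shift sum_subtractf[symmetric]
    proof (rule sum.cong)
      fix j show "q ^ j * A j * bailey_kernel 0 q n j
          - (if j = 0 then 0 else q ^ (j - 1) * A (j - 1)) * bailey_kernel 0 q n j
          = \<alpha>' j * bailey_kernel 0 q n j"
        by (cases j) (simp_all add: \<alpha>' A0 algebra_simps)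
    qed simp
    finally show ?thesis .
  qed
  then show ?thesis by (simp add: bailey_pair_one_iff \<alpha>')
qed

end

section \<open>Moments of the Bailey sum\<close>

text \<open>This is the part of \<open>\<alpha>\<close> at 2r in (i) that is free of u and v,
  without (1 - q^(4r+1)) / (1 - q). The exponent exceeds 2r^2 - 2r by 4r because the u-factors and
  the v-factors each release q^(2r), see \<open>even_node_factor\<close>.\<close>

definition even_coeff :: "complex \<Rightarrow> complex \<Rightarrow> complex \<Rightarrow> nat \<Rightarrow> complex" where
  "even_coeff d e q r = q ^ (2 * r\<^sup>2 + 2 * r) * qpochs [d, e] (q\<^sup>2) r /
     (qpochs [q ^ 3 / d, q ^ 3 / e] (q\<^sup>2) r * (d * e) ^ r)"

definition odd_coeff :: "complex \<Rightarrow> complex \<Rightarrow> complex \<Rightarrow> nat \<Rightarrow> complex" where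
  "odd_coeff d e q r = q ^ (2 * r\<^sup>2 + 1) * qpochs [d / q, e / q] (q\<^sup>2) r /
     (qpochs [q\<^sup>2 / d, q\<^sup>2 / e] (q\<^sup>2) r * (d * e) ^ r)"

text \<open>An odd index is j = 2r - 1 with r >= 1, so r is \<open>j div 2 + 1\<close>.\<close>

definition coeff :: "complex \<Rightarrow> complex \<Rightarrow> complex \<Rightarrow> nat \<Rightarrow> complex" where
  "coeff d e q j =
     (if even j then even_coeff d e q (j div 2) else - odd_coeff d e q (j div 2 + 1))"

definition moment :: "complex \<Rightarrow> complex \<Rightarrow> complex \<Rightarrow> nat \<Rightarrow> nat \<Rightarrow> complex" where
  "moment d e q k n =
     (\<Sum>j\<le>n. (1 - q ^ (2 * j + 1)) * coeff d e q j * node q j ^ k * bailey_kernel 1 q n j)"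

text \<open>The ratio $M_1/M_0$ at $Q = q^n$.\<close>

definition mean :: "complex \<Rightarrow> complex \<Rightarrow> complex \<Rightarrow> complex \<Rightarrow> complex" where
  "mean d e q Q =
     (q * (q + 1) * Q + q * (d + e) * (Q\<^sup>2 - 1) - (q + 1) * d * e * Q) / (q * Q\<^sup>2 - d * e)"

text \<open>The conditions on d and e keep (q^2/d;q)_n and (q^2/e;q)_n nonzero. The condition on de
  covers both factors of the denominator of K that involve d and e: with Q = q^n these are q Q^2 -
  de and Q^2 - q de, up to powers of q and Q.\<close>

locale bailey_parameters = nonroot +
  fixes d e :: complex
  assumes d_nonzero: "d \<noteq> 0" and e_nonzero: "e \<noteq> 0"
    and d_generic: "\<And>n. d \<noteq> q ^ (n + 2)"
    and e_generic: "\<And>n. e \<noteq> q ^ (n + 2)"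
    and de_generic: "\<And>n. q * (d * e) \<noteq> q ^ (2 * n)"
begin

section \<open>Term ratios and the telescoping of the sum without u and v\<close>

lemma even_coeff_Suc:
  "even_coeff d e q (Suc s) * ((d - q ^ 3 * q ^ (2 * s)) * (e - q ^ 3 * q ^ (2 * s)))
     = even_coeff d e q s * (q ^ 4 * (q ^ (2 * s))\<^sup>2 * (1 - d * q ^ (2 * s)) * (1 - e * q ^ (2 * s)))"
proof -
  define x where "x = q ^ (2 * s)"
  have nz: "d - q ^ 3 * x \<noteq> 0" "e - q ^ 3 * x \<noteq> 0"
    using d_generic[of "2 * s + 1"] e_generic[of "2 * s + 1"]
    by (auto simp: x_def power_add numeral_3_eq_3)
  have pw: "q ^ (2 * (Suc s)\<^sup>2 + 2 * Suc s) = q ^ (2 * s\<^sup>2 + 2 * s) * (q ^ 4 * x\<^sup>2)"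
  proof -
    have "2 * (Suc s)\<^sup>2 + 2 * Suc s = 2 * s\<^sup>2 + 2 * s + (4 + 2 * s * 2)"
      by (simp add: power2_eq_square)
    then show ?thesis by (simp only: x_def power_add power_mult)
  qed
  have x: "(q\<^sup>2) ^ s = x" by (simp add: x_def power_mult)
  have fac: "1 - q ^ 3 / d * x = (d - q ^ 3 * x) / d" "1 - q ^ 3 / e * x = (e - q ^ 3 * x) / e"
    using d_nonzero e_nonzero by (simp_all add: field_simps)
  show ?thesis
    unfolding even_coeff_def pw qpochs_def qpoch_Suc list.map prod_list.Cons prod_list.Nil x fac
      x_def[symmetric] power_Suc
    using nz d_nonzero e_nonzero by (simp add: mult_ac)
qed

lemma odd_coeff_Suc:
  "odd_coeff d e q (Suc r) * ((d - q\<^sup>2 * q ^ (2 * r)) * (e - q\<^sup>2 * q ^ (2 * r)))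
     = odd_coeff d e q r * ((q ^ (2 * r))\<^sup>2 * (q - d * q ^ (2 * r)) * (q - e * q ^ (2 * r)))"
proof -
  define x where "x = q ^ (2 * r)"
  have nz: "d - q\<^sup>2 * x \<noteq> 0" "e - q\<^sup>2 * x \<noteq> 0"
    using d_generic[of "2 * r"] e_generic[of "2 * r"]
    by (auto simp: x_def power_add power2_eq_square)
  have pw: "q ^ (2 * (Suc r)\<^sup>2 + 1) = q ^ (2 * r\<^sup>2 + 1) * (q\<^sup>2 * x\<^sup>2)"
  proof -
    have "2 * (Suc r)\<^sup>2 + 1 = 2 * r\<^sup>2 + 1 + (2 + 2 * r * 2)"
      by (simp add: power2_eq_square)
    then show ?thesis by (simp only: x_def power_add power_mult)
  qed
  have x: "(q\<^sup>2) ^ r = x" by (simp add: x_def power_mult)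
  have fac: "1 - q\<^sup>2 / d * x = (d - q\<^sup>2 * x) / d" "1 - q\<^sup>2 / e * x = (e - q\<^sup>2 * x) / e"
    "1 - d / q * x = (q - d * x) / q" "1 - e / q * x = (q - e * x) / q"
    using d_nonzero e_nonzero q_nonzero by (simp_all add: field_simps)
  show ?thesis
    unfolding odd_coeff_def pw qpochs_def qpoch_Suc list.map prod_list.Cons prod_list.Nil x fac
      x_def[symmetric] power_Suc
    using nz d_nonzero e_nonzero q_nonzero by (simp add: mult_ac) (simp add: power2_eq_square)
qed

lemma even_coeff_0: "even_coeff d e q 0 = 1"
  by (simp add: even_coeff_def qpochs_def)

lemma odd_coeff_0: "odd_coeff d e q 0 = q"
  by (simp add: odd_coeff_def qpochs_def)

text \<open>Within one parity class the index advances by two.\<close>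

lemma bailey_kernel_Suc_Suc:
  "bailey_kernel 1 q n (Suc (Suc j)) *
     ((1 - q ^ n * (q ^ 3 * q ^ j)) * (1 - q ^ n * (q\<^sup>2 * q ^ j)) * (q * (q ^ j)\<^sup>2))
     = bailey_kernel 1 q n j * ((q ^ j - q ^ n) * (q * q ^ j - q ^ n))"
proof -
  have 1: "bailey_kernel 1 q n (Suc j) * ((1 - q ^ n * (q\<^sup>2 * q ^ j)) * q ^ j)
      = bailey_kernel 1 q n j * (q ^ j - q ^ n)"
    using bailey_kernel_Suc_right[of 1 n j] by (simp add: power_add power2_eq_square mult_ac)
  have 2: "bailey_kernel 1 q n (Suc (Suc j)) * ((1 - q ^ n * (q ^ 3 * q ^ j)) * (q * q ^ j))
      = bailey_kernel 1 q n (Suc j) * (q * q ^ j - q ^ n)"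
    using bailey_kernel_Suc_right[of 1 n "Suc j"]
    by (simp add: power_add power3_eq_cube mult_ac)
  have "bailey_kernel 1 q n (Suc (Suc j)) *
     ((1 - q ^ n * (q ^ 3 * q ^ j)) * (1 - q ^ n * (q\<^sup>2 * q ^ j)) * (q * (q ^ j)\<^sup>2))
    = (bailey_kernel 1 q n (Suc (Suc j)) * ((1 - q ^ n * (q ^ 3 * q ^ j)) * (q * q ^ j)))
      * ((1 - q ^ n * (q\<^sup>2 * q ^ j)) * q ^ j)"
    by (simp add: power2_eq_square mult_ac)
  also have "\<dots> = (bailey_kernel 1 q n (Suc j) * ((1 - q ^ n * (q\<^sup>2 * q ^ j)) * q ^ j))
      * (q * q ^ j - q ^ n)"
    unfolding 2 by (simp only: mult_ac)
  also have "\<dots> = bailey_kernel 1 q n j * ((q ^ j - q ^ n) * (q * q ^ j - q ^ n))"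
    unfolding 1 by (simp only: mult_ac)
  finally show ?thesis .
qed

text \<open>This is y_j minus \<open>mean\<close> at Q = q^n, multiplied by the denominator of
  \<open>mean\<close>. Its weighted sum being 0 is therefore the formula for M_1 / M_0.\<close>

definition relation :: "nat \<Rightarrow> nat \<Rightarrow> complex" where
  "relation n j = (q * (q ^ n)\<^sup>2 - d * e) * node q j
     - (q * (q + 1) * q ^ n + q * (d + e) * ((q ^ n)\<^sup>2 - 1) - (q + 1) * d * e * q ^ n)"

text \<open>Antidifferences of the relation. Under $j = 2r$ for $r \ge 0$ and $j = -2r - 1$ for $r < 0$
  they are the two halves of one bilateral certificate: \<open>odd_cert n s\<close> stands for \<open>- even_cert n (-s)\<close>.\<close>

definition even_cert :: "nat \<Rightarrow> nat \<Rightarrow> complex" where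
  "even_cert n s = (let x = q ^ (2 * s); Q = q ^ n in
     even_coeff d e q s * bailey_kernel 1 q n (2 * s) *
       ((d - q * x) * (e - q * x) * (1 - Q * q * x) * (1 - Q * x)) / x)"

definition odd_cert :: "nat \<Rightarrow> nat \<Rightarrow> complex" where
  "odd_cert n s = (let z = q ^ (2 * s + 2); Q = q ^ n in
     - (odd_coeff d e q (Suc s) * bailey_kernel 1 q n (2 * s + 1) *
       ((z - d) * (z - e) * (1 - Q * z) * (q - Q * z)) / z))"

lemma even_cert_diff:
  "(1 - q ^ (2 * (2 * s) + 1)) * coeff d e q (2 * s) * relation n (2 * s)
       * bailey_kernel 1 q n (2 * s)
     = even_cert n (Suc s) - even_cert n s"
proof -
  define x where "x = q ^ (2 * s)"
  define Q where "Q = q ^ n"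
  define c where "c = even_coeff d e q s"
  define c' where "c' = even_coeff d e q (Suc s)"
  define k where "k = bailey_kernel 1 q n (2 * s)"
  define k' where "k' = bailey_kernel 1 q n (Suc (Suc (2 * s)))"
  have x: "x \<noteq> 0" using q_nonzero by (simp add: x_def)
  have c': "c' * ((d - q ^ 3 * x) * (e - q ^ 3 * x)) = c * (q ^ 4 * x\<^sup>2 * (1 - d * x) * (1 - e * x))"
    using even_coeff_Suc[of s] by (simp add: x_def c_def c'_def)
  have k': "k' * ((1 - Q * (q ^ 3 * x)) * (1 - Q * (q\<^sup>2 * x)) * (q * x\<^sup>2))
      = k * ((x - Q) * (q * x - Q))"
    using bailey_kernel_Suc_Suc[of n "2 * s"] by (simp add: x_def Q_def k_def k'_def)
  have sx: "q ^ (2 * Suc s) = q\<^sup>2 * x"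
    by (simp add: x_def power2_eq_square)
  have "even_cert n (Suc s) = c' * k' * ((d - q * (q\<^sup>2 * x)) * (e - q * (q\<^sup>2 * x))
      * (1 - Q * q * (q\<^sup>2 * x)) * (1 - Q * (q\<^sup>2 * x))) / (q\<^sup>2 * x)"
    unfolding even_cert_def Let_def sx by (simp add: c'_def k'_def Q_def)
  also have "\<dots> = (c' * ((d - q ^ 3 * x) * (e - q ^ 3 * x)))
      * (k' * ((1 - Q * (q ^ 3 * x)) * (1 - Q * (q\<^sup>2 * x)) * (q * x\<^sup>2))) / (q ^ 3 * x ^ 3)"
    using x q_nonzero by (simp add: power2_eq_square power3_eq_cube mult_ac)
  also have "\<dots> = c * k * (q * (1 - d * x) * (1 - e * x) * (x - Q) * (q * x - Q)) / x"
    unfolding c' k' using x q_nonzero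
    by (simp add: power2_eq_square power3_eq_cube power4_eq_xxxx mult_ac)
  finally have up: "even_cert n (Suc s) = \<dots>" .
  have down: "even_cert n s = c * k * ((d - q * x) * (e - q * x) * (1 - Q * q * x) * (1 - Q * x)) / x"
    by (simp add: even_cert_def Let_def c_def k_def x_def Q_def)
  have rel: "relation n (2 * s) = ((q * Q\<^sup>2 - d * e) * (1 + q * x\<^sup>2)
     - (q * (q + 1) * Q + q * (d + e) * (Q\<^sup>2 - 1) - (q + 1) * d * e * Q) * x) / x"
  proof -
    have "q ^ (2 * s + 1) = q * x" by (simp add: x_def)
    then have nd: "node q (2 * s) = (1 + q * x\<^sup>2) / x"
      unfolding node_def x_def[symmetric] using x by (simp add: power2_eq_square field_simps)
    show ?thesis
      unfolding relation_def nd Q_def[symmetric] using x by (simp add: diff_divide_distrib)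
  qed
  have pw: "q ^ (2 * (2 * s) + 1) = q * x\<^sup>2"
    by (simp add: x_def power_mult[symmetric] mult.commute)
  have co: "coeff d e q (2 * s) = c"
    by (simp add: coeff_def c_def)
  \<comment> \<open>The right side is P(x) - q^2 x^4 P(1/(qx)) with P the first product. It is
    antisymmetric under x -> 1/(qx), hence divisible by 1 - q x^2, and the quotient is a combination
    of 1 + q x^2 and x, that is, x times a linear function of y_j. Its coefficients are those of
    \<open>relation\<close>.\<close>
  have poly: "(1 - q * x\<^sup>2) * ((q * Q\<^sup>2 - d * e) * (1 + q * x\<^sup>2)
     - (q * (q + 1) * Q + q * (d + e) * (Q\<^sup>2 - 1) - (q + 1) * d * e * Q) * x)
     = q * (1 - d * x) * (1 - e * x) * (x - Q) * (q * x - Q)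
       - (d - q * x) * (e - q * x) * (1 - Q * q * x) * (1 - Q * x)"
    by algebra
  have "(1 - q ^ (2 * (2 * s) + 1)) * coeff d e q (2 * s) * relation n (2 * s)
      * bailey_kernel 1 q n (2 * s)
    = c * k * ((1 - q * x\<^sup>2) * ((q * Q\<^sup>2 - d * e) * (1 + q * x\<^sup>2)
     - (q * (q + 1) * Q + q * (d + e) * (Q\<^sup>2 - 1) - (q + 1) * d * e * Q) * x)) / x"
    unfolding pw co rel k_def[symmetric]
    by (simp only: times_divide_eq_right times_divide_eq_left mult_ac)
  also have "\<dots> = even_cert n (Suc s) - even_cert n s"
    unfolding up down poly by (simp only: diff_divide_distrib right_diff_distrib)
  finally show ?thesis .
qed

lemma odd_cert_diff:
  "(1 - q ^ (2 * (2 * s + 1) + 1)) * coeff d e q (2 * s + 1) * relation n (2 * s + 1)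
       * bailey_kernel 1 q n (2 * s + 1)
     = odd_cert n (Suc s) - odd_cert n s"
proof -
  define z where "z = q ^ (2 * s + 2)"
  define Q where "Q = q ^ n"
  define c where "c = odd_coeff d e q (Suc s)"
  define c' where "c' = odd_coeff d e q (Suc (Suc s))"
  define k where "k = bailey_kernel 1 q n (2 * s + 1)"
  define k' where "k' = bailey_kernel 1 q n (Suc (Suc (2 * s + 1)))"
  define y where "y = q ^ (2 * s + 1)"
  have y: "y \<noteq> 0" using q_nonzero by (simp add: y_def)
  have zy: "z = q * y" by (simp add: z_def y_def)
  have c': "c' * ((d - q\<^sup>2 * z) * (e - q\<^sup>2 * z)) = c * (z\<^sup>2 * (q - d * z) * (q - e * z))"
    using odd_coeff_Suc[of "Suc s"] by (simp add: z_def c_def c'_def)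
  have k': "k' * ((1 - Q * (q ^ 3 * y)) * (1 - Q * (q\<^sup>2 * y)) * (q * y\<^sup>2))
      = k * ((y - Q) * (q * y - Q))"
    using bailey_kernel_Suc_Suc[of n "2 * s + 1"] unfolding y_def Q_def k_def k'_def .
  have sz: "q ^ (2 * Suc s + 2) = q\<^sup>2 * z"
    by (simp add: z_def power2_eq_square)
  have "odd_cert n (Suc s) = - (c' * k' * ((q\<^sup>2 * z - d) * (q\<^sup>2 * z - e)
      * (1 - Q * (q\<^sup>2 * z)) * (q - Q * (q\<^sup>2 * z))) / (q\<^sup>2 * z))"
    unfolding odd_cert_def Let_def sz by (simp add: c'_def k'_def Q_def)
  also have "\<dots> = - ((c' * ((d - q\<^sup>2 * z) * (e - q\<^sup>2 * z)))
      * (k' * ((1 - Q * (q ^ 3 * y)) * (1 - Q * (q\<^sup>2 * y)) * (q * y\<^sup>2))) / (q ^ 3 * y ^ 3))"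
  proof -
    have "(q\<^sup>2 * z - d) * (q\<^sup>2 * z - e) * (1 - Q * (q\<^sup>2 * z)) * (q - Q * (q\<^sup>2 * z)) =
        q * ((d - q\<^sup>2 * z) * (e - q\<^sup>2 * z) * (1 - Q * (q ^ 3 * y)) * (1 - Q * (q\<^sup>2 * y)))"
      unfolding zy by algebra
    then show ?thesis
      using y q_nonzero unfolding zy
      by (simp only:) (simp add: power2_eq_square power3_eq_cube mult_ac)
  qed
  also have "\<dots> = - (c * k * ((q - d * z) * (q - e * z) * (z - q * Q) * (z - Q)) / (q * z))"
    unfolding c' k' using y q_nonzero
    by (simp add: zy power2_eq_square power3_eq_cube field_simps)
  finally have up: "odd_cert n (Suc s) = \<dots>" .
  have down: "odd_cert n s = - (c * k * ((z - d) * (z - e) * (1 - Q * z) * (q - Q * z)) / z)"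
    by (simp add: odd_cert_def Let_def c_def k_def z_def Q_def)
  have rel: "relation n (2 * s + 1) = ((q * Q\<^sup>2 - d * e) * (q + z\<^sup>2)
     - (q * (q + 1) * Q + q * (d + e) * (Q\<^sup>2 - 1) - (q + 1) * d * e * Q) * z) / z"
  proof -
    have nd: "node q (2 * s + 1) = (q + z\<^sup>2) / z"
      using y q_nonzero unfolding zy
      by (simp add: node_def y_def power2_eq_square field_simps)
    show ?thesis
      unfolding relation_def nd Q_def[symmetric] using y q_nonzero
      by (simp add: zy diff_divide_distrib)
  qed
  have pw: "1 - q ^ (2 * (2 * s + 1) + 1) = (q - z\<^sup>2) / q"
  proof -
    have "q * q ^ (2 * (2 * s + 1) + 1) = z\<^sup>2"
      unfolding z_def by (simp flip: power_mult power_Suc)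
    then show ?thesis using q_nonzero by (simp add: field_simps)
  qed
  have co: "coeff d e q (2 * s + 1) = - c"
    by (simp add: coeff_def c_def)
  \<comment> \<open>The polynomial identity of the even case at x = 1/z, multiplied by -z^4.\<close>
  have poly: "(q - z\<^sup>2) * ((q * Q\<^sup>2 - d * e) * (q + z\<^sup>2)
     - (q * (q + 1) * Q + q * (d + e) * (Q\<^sup>2 - 1) - (q + 1) * d * e * Q) * z)
     = (q - d * z) * (q - e * z) * (z - q * Q) * (z - Q)
       - q * ((z - d) * (z - e) * (1 - Q * z) * (q - Q * z))"
    by algebra
  have "(1 - q ^ (2 * (2 * s + 1) + 1)) * coeff d e q (2 * s + 1) * relation n (2 * s + 1)
      * bailey_kernel 1 q n (2 * s + 1)
    = - (c * k * ((q - z\<^sup>2) * ((q * Q\<^sup>2 - d * e) * (q + z\<^sup>2)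
     - (q * (q + 1) * Q + q * (d + e) * (Q\<^sup>2 - 1) - (q + 1) * d * e * Q) * z)) / (q * z))"
    unfolding pw co rel k_def[symmetric] by simp
  also have "\<dots> = odd_cert n (Suc s) - odd_cert n s"
    unfolding up down poly using y q_nonzero by (simp add: zy diff_divide_distrib right_diff_distrib)
  finally show ?thesis .
qed

text \<open>At s = 0 the two halves of the bilateral certificate meet, so their initial boundary
  terms cancel. The recurrence for \<open>odd_coeff\<close> is started at r = 0, one place before
  its first use in \<open>coeff\<close>.\<close>

lemma cert_0: "even_cert n 0 + odd_cert n 0 = 0"
proof -
  have k: "bailey_kernel 1 q n (Suc 0) * (1 - q ^ n * q\<^sup>2) = bailey_kernel 1 q n 0 * (1 - q ^ n)"
    using bailey_kernel_Suc_right[of 1 n 0] by (simp add: power_add power2_eq_square mult_ac)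
  have c: "odd_coeff d e q (Suc 0) * ((d - q\<^sup>2) * (e - q\<^sup>2)) = q * ((q - d) * (q - e))"
    using odd_coeff_Suc[of 0] by (simp add: odd_coeff_0)
  have "odd_cert n 0 = - ((odd_coeff d e q (Suc 0) * ((d - q\<^sup>2) * (e - q\<^sup>2))) *
      (bailey_kernel 1 q n (Suc 0) * (1 - q ^ n * q\<^sup>2)) * (1 - q ^ n * q) / q)"
  proof -
    have "(q\<^sup>2 - d) * (q\<^sup>2 - e) * (1 - q ^ n * q\<^sup>2) * (q - q ^ n * q\<^sup>2) =
        q * (((d - q\<^sup>2) * (e - q\<^sup>2)) * (1 - q ^ n * q\<^sup>2) * (1 - q ^ n * q))"
      by algebra
    then show ?thesis
      using q_nonzero unfolding odd_cert_def Let_def mult_0_right add_0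
      by (simp only:) (simp add: power2_eq_square mult_ac)
  qed
  also have "\<dots> = - (((q - d) * (q - e)) * (bailey_kernel 1 q n 0 * (1 - q ^ n)) * (1 - q ^ n * q))"
    unfolding k c using q_nonzero by simp
  also have "\<dots> = - even_cert n 0"
    by (simp add: even_cert_def Let_def even_coeff_0 algebra_simps)
  finally show ?thesis by simp
qed

text \<open>Each partial sum over 2m terms equals the sum of the two certificates at m. For m = n +
  1 the additional terms and both certificates contain kernels beyond n, which are 0.\<close>

lemma sum_relation:
  "(\<Sum>j\<le>n. (1 - q ^ (2 * j + 1)) * coeff d e q j * relation n j * bailey_kernel 1 q n j) = 0"
proof -
  let ?t = "\<lambda>j. (1 - q ^ (2 * j + 1)) * coeff d e q j * relation n j * bailey_kernel 1 q n j"
  have part: "(\<Sum>j<2 * m. ?t j) = even_cert n m + odd_cert n m" for m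
  proof (induction m)
    case 0
    show ?case using cert_0 by simp
  next
    case (Suc m)
    have "(\<Sum>j<2 * Suc m. ?t j) = (\<Sum>j<2 * m. ?t j) + ?t (2 * m) + ?t (2 * m + 1)"
      by simp
    then show ?case
      unfolding Suc.IH even_cert_diff odd_cert_diff by simp
  qed
  have "(\<Sum>j\<le>n. ?t j) = (\<Sum>j<2 * Suc n. ?t j)"
    by (rule sum.mono_neutral_left) (auto simp: bailey_kernel_def)
  also have "\<dots> = even_cert n (Suc n) + odd_cert n (Suc n)"
    by (rule part)
  also have "\<dots> = 0"
    by (simp add: even_cert_def odd_cert_def bailey_kernel_def)
  finally show ?thesis .
qed

section \<open>Relations between the moments\<close>

lemma mean_denominator_nonzero: "q * (q ^ n)\<^sup>2 - d * e \<noteq> 0"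
proof
  assume "q * (q ^ n)\<^sup>2 - d * e = 0"
  then have "q * (d * e) = q ^ (2 * Suc n)"
    by (simp add: power2_eq_square mult_2 power_add)
  then show False using de_generic by blast
qed

lemma moment_1: "moment d e q 1 n = mean d e q (q ^ n) * moment d e q 0 n"
proof -
  let ?B = "q * (q ^ n)\<^sup>2 - d * e"
  let ?A = "q * (q + 1) * q ^ n + q * (d + e) * ((q ^ n)\<^sup>2 - 1) - (q + 1) * d * e * q ^ n"
  have "(\<Sum>j\<le>n. (1 - q ^ (2 * j + 1)) * coeff d e q j * relation n j * bailey_kernel 1 q n j)
      = ?B * moment d e q 1 n - ?A * moment d e q 0 n"
    unfolding relation_def moment_def sum_distrib_left sum_subtractf[symmetric]
    by (intro sum.cong refl) (simp add: right_diff_distrib left_diff_distrib mult_ac)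
  then have "?B * moment d e q 1 n = ?A * moment d e q 0 n"
    using sum_relation[of n] by simp
  then show ?thesis
    unfolding mean_def using mean_denominator_nonzero[of n]
    by (metis nonzero_mult_div_cancel_left times_divide_eq_left)
qed

lemma moment_Suc:
  "moment d e q k n = (1 + q * (q ^ Suc n)\<^sup>2) * moment d e q k (Suc n)
     - q ^ Suc n * moment d e q (Suc k) (Suc n)"
proof -
  have pw: "q * (q ^ Suc n)\<^sup>2 = q ^ (2 * n + 3)"
    by (simp add: power_add power_mult power2_eq_square power3_eq_cube power_mult_distrib)
  have "moment d e q k n
     = (\<Sum>j\<le>Suc n. (1 - q ^ (2 * j + 1)) * coeff d e q j * node q j ^ k * bailey_kernel 1 q n j)"
    by (simp add: moment_def bailey_kernel_def)
  then show ?thesis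
    unfolding moment_def sum_distrib_left sum_subtractf[symmetric] pw bailey_kernel_Suc_left[of n]
    by (simp only:) (intro sum.cong refl, simp add: algebra_simps)
qed

end

section \<open>Closed forms and the function \<open>K\<close>\<close>

text \<open>The ratio $M_2/M_0$ at $Q = q^n$, obtained by solving the recurrence for $M_1$.\<close>

definition mean_square :: "complex \<Rightarrow> complex \<Rightarrow> complex \<Rightarrow> complex \<Rightarrow> complex" where
  "mean_square d e q Q = ((1 + q * Q\<^sup>2) * mean d e q Q
     - mean d e q (Q / q) * ((1 - Q\<^sup>2) * (d - q * Q) * (e - q * Q) / (d * e - q * Q\<^sup>2))) / Q"

text \<open>The entire dependence of \<open>\<alpha>\<close> on u and v. Since y_0 = 1 + q, the
  numerator at j = 0 equals the denominator, so the weight is normalised to 1 there.\<close>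

definition K_weight :: "complex \<Rightarrow> complex \<Rightarrow> complex \<Rightarrow> nat \<Rightarrow> complex" where
  "K_weight u v q j = (u\<^sup>2 + q - u * node q j) * (v\<^sup>2 + q - v * node q j)
     / ((1 - u) * (q - u) * (1 - v) * (q - v))"

text \<open>For b = 1/Q and c = q/Q each bracket of K is, up to powers of q and Q, one of the
  polynomials \<open>N1\<close>, \<open>N2\<close>, \<open>B1\<close>, \<open>B0\<close>,
  \<open>R\<close>. The ratios \<open>N1 / B1\<close> and \<open>N / (B0 * B1)\<close> are the two
  means.\<close>

lemma K_eq_means:
  assumes "q \<noteq> 0" "Q \<noteq> 0" "q * Q\<^sup>2 - d * e \<noteq> 0" "Q\<^sup>2 - q * (d * e) \<noteq> 0"
  shows "K q (1 / Q) (q / Q) d e u v (q\<^sup>2)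
    = (u * v * mean_square d e q Q - (u + v) * (q + u * v) * mean d e q Q + (u\<^sup>2 + q) * (v\<^sup>2 + q))
      / ((1 - u) * (q - u) * (1 - v) * (q - v))"
proof -
  define B1 where "B1 = q * Q\<^sup>2 - d * e"
  define B0 where "B0 = Q\<^sup>2 - q * (d * e)"
  define N1 where "N1 = q * (q + 1) * Q + q * (d + e) * (Q\<^sup>2 - 1) - (q + 1) * d * e * Q"
  define N0 where "N0 = q * (q + 1) * Q + (d + e) * (Q\<^sup>2 - q\<^sup>2) - (q + 1) * d * e * Q"
  define N2 where "N2 = (1 + q) * Q + (d + e) * (Q\<^sup>2 - q\<^sup>2) - q * (1 + q) * d * e * Q"
  define R where "R = q * Q\<^sup>2 - q - (1 + q) * (d + e) * Q - d * e * Q\<^sup>2 + d * e"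
  \<comment> \<open>These are the first two terms of the numerator of K, stripped of u v and of
    powers of q and Q. The identity for \<open>Q * N\<close> below shows that the division by Q in
    \<open>mean_square\<close> is exact.\<close>
  define N where "N = N1 * N2 + (1 - q\<^sup>2) * B1 * R"
  have B: "B1 \<noteq> 0" "B0 \<noteq> 0" using assms by (auto simp: B1_def B0_def)
  have N: "Q * N = (1 + q * Q\<^sup>2) * N1 * B0 + N0 * ((1 - Q\<^sup>2) * (d - q * Q) * (e - q * Q))"
    unfolding N_def N1_def N0_def N2_def R_def B0_def B1_def by algebra
  have m1: "mean d e q Q = N1 / B1"
    by (simp add: mean_def N1_def B1_def)
  have m0: "mean d e q (Q / q) = N0 / B0"
  proof -
    have "q * (q + 1) * (Q / q) + q * (d + e) * ((Q / q)\<^sup>2 - 1) - (q + 1) * d * e * (Q / q) = N0 / q"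
      using assms(1) by (simp add: N0_def power2_eq_square field_simps)
    moreover have "q * (Q / q)\<^sup>2 - d * e = B0 / q"
      using assms(1) by (simp add: B0_def power2_eq_square field_simps)
    ultimately show ?thesis
      using assms(1) by (simp add: mean_def)
  qed
  have "mean_square d e q Q
      = ((1 + q * Q\<^sup>2) * (N1 / B1) - N0 / B0 * ((1 - Q\<^sup>2) * (d - q * Q) * (e - q * Q) / (- B1))) / Q"
    unfolding mean_square_def m1 m0 by (simp add: B1_def)
  also have "\<dots> = ((1 + q * Q\<^sup>2) * N1 * B0 + N0 * ((1 - Q\<^sup>2) * (d - q * Q) * (e - q * Q))) / (Q * (B0 * B1))"
  proof -
    have "(a * (b / B1) - c / B0 * (f / (- B1))) / Q = (a * b * B0 + c * f) / (Q * (B0 * B1))"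
      for a b c f :: complex
      using B assms(2) by (simp add: field_simps)
    then show ?thesis .
  qed
  finally have m2: "mean_square d e q Q = N / (B0 * B1)"
    unfolding N[symmetric] using assms(2) by simp
  define b where "b = 1 / Q"
  define c where "c = q / Q"
  have s3: "b * c * d + b * c * e + b * d * e + c * d * e - q * (b + c + d + e) = - N1 / Q\<^sup>2"
    using assms(2) by (simp add: b_def c_def N1_def power2_eq_square field_simps)
  have s3': "q\<^sup>2 * (b * c * d + b * c * e + b * d * e + c * d * e) - q * (b + c + d + e) = - (q * N2) / Q\<^sup>2"
    using assms(2) by (simp add: b_def c_def N2_def power2_eq_square field_simps)
  have s4: "q\<^sup>2 - b * c * d * e = q * B1 / Q\<^sup>2"
    using assms(2) by (simp add: b_def c_def B1_def power2_eq_square field_simps)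
  have s4': "q\<^sup>2 - q\<^sup>2 * (b * c * d * e) = q\<^sup>2 * B0 / Q\<^sup>2"
    using assms(2) by (simp add: b_def c_def B0_def power2_eq_square field_simps)
  have s2: "q\<^sup>2 - (b * c + b * d + b * e + c * d + c * e + d * e) * q + b * c * d * e = q * R / Q\<^sup>2"
    using assms(2) by (simp add: b_def c_def R_def power2_eq_square field_simps)
  have den: "K_den q b c d e u v (q\<^sup>2)
      = q ^ 3 * (B0 * B1) / Q ^ 4 * ((1 - u) * (q - u) * (1 - v) * (q - v))"
  proof -
    have "K_den q b c d e u v (q\<^sup>2)
        = (q * B1 / Q\<^sup>2) * (q\<^sup>2 * B0 / Q\<^sup>2) * ((1 - u) * (q - u) * (1 - v) * (q - v))"
      unfolding K_den_def s4[symmetric] s4'[symmetric] by (simp only: mult_ac)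
    then show ?thesis
      by (simp add: power2_eq_square power3_eq_cube power4_eq_xxxx mult_ac)
  qed
  have num: "K_num q b c d e u v (q\<^sup>2)
      = q ^ 3 / Q ^ 4 * (u * v * N - (u + v) * (q + u * v) * (N1 * B0) + (u\<^sup>2 + q) * (v\<^sup>2 + q) * (B0 * B1))"
    unfolding K_num_def Let_def s3 s3' s4 s4' s2 N_def using assms(2)
    by (simp add: power2_eq_square power3_eq_cube power4_eq_xxxx field_simps)
  have "K q b c d e u v (q\<^sup>2)
      = (u * v * N - (u + v) * (q + u * v) * (N1 * B0) + (u\<^sup>2 + q) * (v\<^sup>2 + q) * (B0 * B1))
        / (B0 * B1) / ((1 - u) * (q - u) * (1 - v) * (q - v))"
    unfolding K_def num den using assms(1,2) by simp
  also have "(u * v * N - (u + v) * (q + u * v) * (N1 * B0) + (u\<^sup>2 + q) * (v\<^sup>2 + q) * (B0 * B1)) / (B0 * B1)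
      = u * v * mean_square d e q Q - (u + v) * (q + u * v) * mean d e q Q + (u\<^sup>2 + q) * (v\<^sup>2 + q)"
    unfolding m1 m2 using B by (simp add: add_divide_distrib diff_divide_distrib)
  finally show ?thesis by (simp add: b_def c_def)
qed

context bailey_parameters
begin

section \<open>Closed forms of the moments, and the pair with the u, v weight\<close>

lemma moment_at_0: "moment d e q k 0 = (1 + q) ^ k"
  using q_not_root[of 1]
  by (simp add: moment_def coeff_def even_coeff_0 node_def bailey_kernel_def qpoch_Suc)

text \<open>The recurrence in n for k = 0 has the factor 1 + q Q^2 - Q \<open>mean\<close> once M_1
  is replaced. The numerator of this factor splits into linear factors in d and e, which is why M_0
  is a product.\<close>

lemma moment_0_Suc:
  "moment d e q 0 n = moment d e q 0 (Suc n) *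
     ((1 - (q ^ Suc n)\<^sup>2) * (d - q * q ^ Suc n) * (e - q * q ^ Suc n) / (d * e - q * (q ^ Suc n)\<^sup>2))"
proof -
  define Q where "Q = q ^ Suc n"
  have B: "q * Q\<^sup>2 - d * e \<noteq> 0" "d * e - q * Q\<^sup>2 \<noteq> 0"
    using mean_denominator_nonzero[of "Suc n"] by (auto simp: Q_def)
  have "(1 + q * Q\<^sup>2 - Q * mean d e q Q) * (q * Q\<^sup>2 - d * e)
      = (1 + q * Q\<^sup>2) * (q * Q\<^sup>2 - d * e)
        - Q * (q * (q + 1) * Q + q * (d + e) * (Q\<^sup>2 - 1) - (q + 1) * d * e * Q)"
    using B(1) by (simp add: mean_def left_diff_distrib)
  also have "\<dots> = - ((1 - Q\<^sup>2) * (d - q * Q) * (e - q * Q))"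
    by algebra
  finally have neg: "(1 + q * Q\<^sup>2 - Q * mean d e q Q) * (q * Q\<^sup>2 - d * e)
      = - ((1 - Q\<^sup>2) * (d - q * Q) * (e - q * Q))" .
  have "(1 + q * Q\<^sup>2 - Q * mean d e q Q) * (d * e - q * Q\<^sup>2)
      = - ((1 + q * Q\<^sup>2 - Q * mean d e q Q) * (q * Q\<^sup>2 - d * e))"
    by (simp add: right_diff_distrib)
  also have "\<dots> = (1 - Q\<^sup>2) * (d - q * Q) * (e - q * Q)"
    unfolding neg by simp
  finally have "(1 + q * Q\<^sup>2 - Q * mean d e q Q) * (d * e - q * Q\<^sup>2)
      = (1 - Q\<^sup>2) * (d - q * Q) * (e - q * Q)" .
  then have *: "1 + q * Q\<^sup>2 - Q * mean d e q Q
      = (1 - Q\<^sup>2) * (d - q * Q) * (e - q * Q) / (d * e - q * Q\<^sup>2)"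
    using B(2) by (simp add: eq_divide_eq)
  have "moment d e q 0 n = moment d e q 0 (Suc n) * (1 + q * Q\<^sup>2 - Q * mean d e q Q)"
    using moment_Suc[of 0 n] moment_1[of "Suc n"] by (simp add: Q_def algebra_simps)
  then show ?thesis unfolding * unfolding Q_def .
qed

lemma moment_2: "moment d e q 2 n = mean_square d e q (q ^ n) * moment d e q 0 n"
proof (cases n)
  case 0
  \<comment> \<open>There is no smaller n to descend to. At Q = 1 the factor 1 - Q^2 removes the
    second mean from \<open>mean_square\<close>, leaving (1 + q)^2.\<close>
  have "mean d e q 1 = 1 + q"
    using mean_denominator_nonzero[of 0] by (simp add: mean_def field_simps)
  then show ?thesis
    by (simp add: 0 moment_at_0 mean_square_def power2_eq_square)
next
  case (Suc m)
  define Q where "Q = q ^ Suc m"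
  let ?f = "(1 - Q\<^sup>2) * (d - q * Q) * (e - q * Q) / (d * e - q * Q\<^sup>2)"
  have Q: "Q \<noteq> 0" and Qq: "q ^ m = Q / q" using q_nonzero by (auto simp: Q_def)
  have "mean d e q (Q / q) * (moment d e q 0 n * ?f)
      = (1 + q * Q\<^sup>2) * (mean d e q Q * moment d e q 0 n) - Q * moment d e q 2 n"
  proof -
    have m: "moment d e q 0 m = moment d e q 0 n * ?f"
      using moment_0_Suc[of m] unfolding Suc Q_def .
    have "moment d e q 1 m = mean d e q (Q / q) * moment d e q 0 m"
      using moment_1[of m] unfolding Qq .
    moreover have "moment d e q 1 m = (1 + q * Q\<^sup>2) * moment d e q 1 n - Q * moment d e q 2 n"
      using moment_Suc[of 1 m, unfolded Suc_1] unfolding Suc Q_def .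
    moreover have "moment d e q 1 n = mean d e q Q * moment d e q 0 n"
      using moment_1[of n] unfolding Suc Q_def .
    ultimately show ?thesis unfolding m by simp
  qed
  then have "Q * moment d e q 2 n
      = ((1 + q * Q\<^sup>2) * mean d e q Q - mean d e q (Q / q) * ?f) * moment d e q 0 n"
    by (simp add: algebra_simps)
  then have "moment d e q 2 n
      = ((1 + q * Q\<^sup>2) * mean d e q Q - mean d e q (Q / q) * ?f) * moment d e q 0 n / Q"
    using Q by (metis nonzero_mult_div_cancel_left)
  then show ?thesis
    unfolding mean_square_def Suc Q_def by (simp only: times_divide_eq_left)
qed

lemma moment_0:
  "moment d e q 0 n = qpoch (q ^ 3 / (d * e)) (q\<^sup>2) n /
     (qpoch (q\<^sup>2) (q\<^sup>2) n * qpochs [q\<^sup>2 / d, q\<^sup>2 / e] q n)"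
proof (induction n)
  case 0
  show ?case by (simp add: moment_at_0 qpochs_def)
next
  case (Suc n)
  define Q where "Q = q ^ Suc n"
  have nz: "1 - Q\<^sup>2 \<noteq> 0" "d - q * Q \<noteq> 0" "e - q * Q \<noteq> 0" "d * e - q * Q\<^sup>2 \<noteq> 0"
  proof -
    show "1 - Q\<^sup>2 \<noteq> 0"
      using one_minus_power_nonzero[of "Suc n * 2"] unfolding Q_def power_mult by simp
    show "d - q * Q \<noteq> 0" "e - q * Q \<noteq> 0"
      using d_generic[of n] e_generic[of n] by (auto simp: Q_def)
    show "d * e - q * Q\<^sup>2 \<noteq> 0"
      using mean_denominator_nonzero[of "Suc n"] unfolding Q_def by (metis eq_iff_diff_eq_0)
  qed
  have pw: "q\<^sup>2 * (q\<^sup>2) ^ n = Q\<^sup>2" "q\<^sup>2 * q ^ n = q * Q"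
    by (simp_all add: Q_def power2_eq_square power_mult_distrib)
  have fac: "1 - q ^ 3 / (d * e) * (q\<^sup>2) ^ n = (d * e - q * Q\<^sup>2) / (d * e)"
      "1 - q\<^sup>2 / d * q ^ n = (d - q * Q) / d" "1 - q\<^sup>2 / e * q ^ n = (e - q * Q) / e"
  proof -
    have "q ^ 3 / (d * e) * (q\<^sup>2) ^ n = q * Q\<^sup>2 / (d * e)"
      unfolding pw(1)[symmetric] by (simp add: power2_eq_square power3_eq_cube)
    then show "1 - q ^ 3 / (d * e) * (q\<^sup>2) ^ n = (d * e - q * Q\<^sup>2) / (d * e)"
      using d_nonzero e_nonzero by (simp add: diff_divide_distrib)
    show "1 - q\<^sup>2 / d * q ^ n = (d - q * Q) / d" "1 - q\<^sup>2 / e * q ^ n = (e - q * Q) / e"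
      using pw(2) d_nonzero e_nonzero by (simp_all add: diff_divide_distrib)
  qed
  have "moment d e q 0 (Suc n)
      = moment d e q 0 n * ((d * e - q * Q\<^sup>2) / ((1 - Q\<^sup>2) * (d - q * Q) * (e - q * Q)))"
    using nz unfolding moment_0_Suc[of n] Q_def[symmetric] by simp
  also have "\<dots> = qpoch (q ^ 3 / (d * e)) (q\<^sup>2) (Suc n) /
     (qpoch (q\<^sup>2) (q\<^sup>2) (Suc n) * qpochs [q\<^sup>2 / d, q\<^sup>2 / e] q (Suc n))"
    unfolding Suc.IH qpochs_def qpoch_Suc list.map prod_list.Cons prod_list.Nil fac pw
    using d_nonzero e_nonzero by (simp add: mult_ac)
  finally show ?case .
qed

lemma K5_eq_means:
  "K5 d e u v q n =
    (u * v * mean_square d e q (q ^ n) - (u + v) * (q + u * v) * mean d e q (q ^ n)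
      + (u\<^sup>2 + q) * (v\<^sup>2 + q)) / ((1 - u) * (q - u) * (1 - v) * (q - v))"
proof -
  have "q powi (- int n) = 1 / q ^ n" "q powi (1 - int n) = q / q ^ n"
    using q_nonzero by (simp_all add: power_int_minus power_int_diff divide_inverse)
  moreover have "(q ^ n)\<^sup>2 - q * (d * e) \<noteq> 0"
    using de_generic[of n] by (simp add: mult.commute flip: power_mult)
  ultimately show ?thesis
    unfolding K5_def using K_eq_means q_nonzero mean_denominator_nonzero by simp
qed

text \<open>This is (i) before \<open>E_seq\<close> and \<open>F_seq\<close> are recognised: the
  weight is quadratic in y_j, and expanding it gives the combination of M_0, M_1, M_2 that
  \<open>K5_eq_means\<close> describes.\<close>

lemma bailey_pair_K_weight:
  assumes "u \<noteq> 1" "u \<noteq> q" "v \<noteq> 1" "v \<noteq> q"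
  shows "bailey_pair q q
    (\<lambda>j. (1 - q ^ (2 * j + 1)) / (1 - q) * (coeff d e q j * K_weight u v q j))
    (\<lambda>n. K5 d e u v q n * moment d e q 0 n)"
proof -
  let ?C = "(1 - u) * (q - u) * (1 - v) * (q - v)"
  have "K5 d e u v q n * moment d e q 0 n =
    (\<Sum>j\<le>n. (1 - q) * ((1 - q ^ (2 * j + 1)) / (1 - q) * (coeff d e q j * K_weight u v q j))
        * bailey_kernel 1 q n j)" for n
  proof -
    let ?t = "\<lambda>j. (1 - q ^ (2 * j + 1)) * coeff d e q j"
    have "(1 - q) * ((1 - q ^ (2 * j + 1)) / (1 - q) * (coeff d e q j * K_weight u v q j))
        * bailey_kernel 1 q n j
      = (u * v * (?t j * node q j ^ 2 * bailey_kernel 1 q n j)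
          - (u + v) * (q + u * v) * (?t j * node q j ^ 1 * bailey_kernel 1 q n j)
          + (u\<^sup>2 + q) * (v\<^sup>2 + q) * (?t j * node q j ^ 0 * bailey_kernel 1 q n j)) / ?C" for j
    proof -
      have "(u\<^sup>2 + q - u * y) * (v\<^sup>2 + q - v * y) * (t * k) = u * v * (t * y ^ 2 * k)
          - (u + v) * (q + u * v) * (t * y ^ 1 * k) + (u\<^sup>2 + q) * (v\<^sup>2 + q) * (t * y ^ 0 * k)"
        for y t k :: complex
        by (simp add: power2_eq_square algebra_simps)
      from this[symmetric] show ?thesis
        using q_not_root[of 1] by (simp only: K_weight_def) (simp add: mult_ac)
    qed
    then have "(\<Sum>j\<le>n. (1 - q) * ((1 - q ^ (2 * j + 1)) / (1 - q) * (coeff d e q j * K_weight u v q j))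
        * bailey_kernel 1 q n j)
      = (u * v * moment d e q 2 n - (u + v) * (q + u * v) * moment d e q 1 n
          + (u\<^sup>2 + q) * (v\<^sup>2 + q) * moment d e q 0 n) / ?C"
      unfolding moment_def by (simp only: sum_distrib_left sum_subtractf sum.distrib
          sum_divide_distrib[symmetric])
    also have "\<dots> = K5 d e u v q n * moment d e q 0 n"
      unfolding K5_eq_means moment_1 moment_2 by (simp add: algebra_simps)
    finally show ?thesis by simp
  qed
  moreover have "(1 - q ^ (2 * 0 + 1)) / (1 - q) * (coeff d e q 0 * K_weight u v q 0) = 1"
  proof -
    have "(u\<^sup>2 + q - u * (1 + q)) * (v\<^sup>2 + q - v * (1 + q)) = ?C"
      by algebra
    then show ?thesis
      using assms q_not_root[of 1]
      by (simp add: coeff_def even_coeff_0 K_weight_def node_def)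
  qed
  ultimately show ?thesis
    unfolding bailey_pair_q_iff by blast
qed

section \<open>Identification of \<open>E_seq\<close> and \<open>F_seq\<close> with the weighted
  coefficients\<close>

lemma qpoch_ratio:
  assumes "x \<noteq> 1" "\<And>r. qpoch x (q\<^sup>2) r \<noteq> 0"
  shows "qpoch (x * q\<^sup>2) (q\<^sup>2) r / qpoch x (q\<^sup>2) r = (1 - x * q ^ (2 * r)) / (1 - x)"
  unfolding power_mult using qpoch_shift[of x "q\<^sup>2" r] assms by (simp add: field_simps)

text \<open>Pairing u with q/u makes the product symmetric: for x = q^(2r), (1 - u x)(1 - q x / u) =
  x (y - u - q/u) with y the node at 2r. The factor x is what \<open>even_coeff\<close>
  absorbs.\<close>

lemma even_node_factor:
  assumes "u \<noteq> 0" "u \<noteq> q"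
  shows "(1 - u * q ^ (2 * r)) / (1 - u) * ((1 - q / u * q ^ (2 * r)) / (1 - q / u))
     = q ^ (2 * r) * ((u\<^sup>2 + q - u * node q (2 * r)) / ((1 - u) * (q - u)))"
proof -
  define x where "x = q ^ (2 * r)"
  have x: "x \<noteq> 0" using q_nonzero by (simp add: x_def)
  have nd: "node q (2 * r) = (1 + q * x\<^sup>2) / x"
    using x by (simp add: node_def x_def power2_eq_square add_divide_distrib)
  have f: "(1 - q / u * x) / (1 - q / u) = - ((u - q * x) / (q - u))"
  proof -
    have "1 - q / u * x = (u - q * x) / u" "1 - q / u = - ((q - u) / u)"
      using assms by (simp_all add: field_simps)
    then show ?thesis using assms by simp
  qed
  have g: "x * (u\<^sup>2 + q - u * ((1 + q * x\<^sup>2) / x)) = - ((1 - u * x) * (u - q * x))"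
    using x by (simp add: field_simps power2_eq_square)
  show ?thesis
    unfolding x_def[symmetric] nd f times_divide_eq_right[of x] g by simp
qed

text \<open>Here u/q is paired with 1/u: for z = q^(2r), (1 - u z / q)(1 - z / u) = (z / q)(y - u -
  q/u) with y the node at 2r - 1.\<close>

lemma odd_node_factor:
  assumes "u \<noteq> 0" "u \<noteq> 1" "r \<ge> 1"
  shows "(1 - u / q * q ^ (2 * r)) / (1 - u / q) * ((1 - 1 / u * q ^ (2 * r)) / (1 - 1 / u))
     = q ^ (2 * r) * ((u\<^sup>2 + q - u * node q (2 * r - 1)) / ((1 - u) * (q - u)))"
proof -
  define z where "z = q ^ (2 * r)"
  have z: "z \<noteq> 0" using q_nonzero by (simp add: z_def)
  have zq: "q ^ (2 * r - 1) = z / q"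
    using q_nonzero assms(3) by (simp add: z_def power_diff)
  have nd: "node q (2 * r - 1) = (q + z\<^sup>2) / z"
    using z assms(3) unfolding node_def zq by (simp add: z_def power2_eq_square add_divide_distrib)
  have f: "(1 - 1 / u * z) / (1 - 1 / u) = - ((u - z) / (1 - u))"
  proof -
    have "1 - 1 / u * z = (u - z) / u" "1 - 1 / u = - ((1 - u) / u)"
      using assms by (simp_all add: field_simps)
    then show ?thesis using assms by simp
  qed
  have f': "(1 - u / q * z) / (1 - u / q) = (q - u * z) / (q - u)"
  proof -
    have "1 - u / q * z = (q - u * z) / q" "1 - u / q = (q - u) / q"
      using q_nonzero by (simp_all add: field_simps)
    then show ?thesis using q_nonzero by simp
  qed
  have g: "z * (u\<^sup>2 + q - u * ((q + z\<^sup>2) / z)) = - ((q - u * z) * (u - z))"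
    using z by (simp add: field_simps power2_eq_square)
  show ?thesis
    unfolding z_def[symmetric] nd f f' times_divide_eq_right[of z] g by (simp add: mult_ac)
qed

lemma E_seq_eq_coeff:
  assumes "u \<noteq> 0" "u \<noteq> 1" "u \<noteq> q" "v \<noteq> 0" "v \<noteq> 1" "v \<noteq> q"
    and "\<And>r. qpoch u (q\<^sup>2) r \<noteq> 0" "\<And>r. qpoch (q / u) (q\<^sup>2) r \<noteq> 0"
    and "\<And>r. qpoch v (q\<^sup>2) r \<noteq> 0" "\<And>r. qpoch (q / v) (q\<^sup>2) r \<noteq> 0"
  shows "q powi (2 * (int r)\<^sup>2 - 2 * int r) * E_seq d e u v q r
    = coeff d e q (2 * r) * K_weight u v q (2 * r)"
proof -
  define D where "D = qpochs [d, e] (q\<^sup>2) r / (qpochs [q ^ 3 / d, q ^ 3 / e] (q\<^sup>2) r * (d * e) ^ r)"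
  have sh: "q\<^sup>2 * u = u * q\<^sup>2" "q\<^sup>2 * v = v * q\<^sup>2" "q ^ 3 / u = q / u * q\<^sup>2" "q ^ 3 / v = q / v * q\<^sup>2"
    by (simp_all add: power2_eq_square power3_eq_cube)
  have rat: "qpoch (x * q\<^sup>2) (q\<^sup>2) r / qpoch x (q\<^sup>2) r = (1 - x * q ^ (2 * r)) / (1 - x)"
    if "x \<in> {u, v, q / u, q / v}" for x
    using that assms by (intro qpoch_ratio) auto
  have "E_seq d e u v q r = D
      * (qpoch (u * q\<^sup>2) (q\<^sup>2) r / qpoch u (q\<^sup>2) r * (qpoch (q / u * q\<^sup>2) (q\<^sup>2) r / qpoch (q / u) (q\<^sup>2) r))
      * (qpoch (v * q\<^sup>2) (q\<^sup>2) r / qpoch v (q\<^sup>2) r * (qpoch (q / v * q\<^sup>2) (q\<^sup>2) r / qpoch (q / v) (q\<^sup>2) r))"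
    unfolding E_seq_def D_def qpochs_def list.map prod_list.Cons prod_list.Nil sh
    by (simp only: times_divide_times_eq mult_1_right mult_ac)
  also have "\<dots> = D * (q ^ (2 * r) * q ^ (2 * r)) * K_weight u v q (2 * r)"
  proof -
    have rats: "qpoch (w * q\<^sup>2) (q\<^sup>2) r / qpoch w (q\<^sup>2) r
        * (qpoch (q / w * q\<^sup>2) (q\<^sup>2) r / qpoch (q / w) (q\<^sup>2) r)
        = q ^ (2 * r) * ((w\<^sup>2 + q - w * node q (2 * r)) / ((1 - w) * (q - w)))"
      if "w \<in> {u, v}" for w
    proof -
      have w: "w \<in> {u, v, q / u, q / v}" "q / w \<in> {u, v, q / u, q / v}" and "w \<noteq> 0" "w \<noteq> q"
        using that assms(1,3,4,6) by auto
      then show ?thesis unfolding w[THEN rat] by (intro even_node_factor)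
    qed
    show ?thesis
      unfolding rats[of u, OF insertI1] rats[of v, OF insertI2[OF singletonI]] K_weight_def
      by (simp add: mult_ac)
  qed
  finally have E: "E_seq d e u v q r = \<dots>" .
  \<comment> \<open>One q^(2r) comes from the u-pair and one from the v-pair.\<close>
  have "q powi (2 * (int r)\<^sup>2 - 2 * int r) * (q ^ (2 * r) * q ^ (2 * r)) = q ^ (2 * r\<^sup>2 + 2 * r)"
    using q_nonzero unfolding power_int_of_nat[symmetric] by (simp flip: power_int_add)
      (simp add: add.commute)
  then show ?thesis
    unfolding E by (simp add: coeff_def even_coeff_def D_def mult_ac)
qed

lemma F_seq_eq_coeff:
  assumes "u \<noteq> 0" "u \<noteq> 1" "u \<noteq> q" "v \<noteq> 0" "v \<noteq> 1" "v \<noteq> q"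
    and "\<And>r. qpoch (u / q) (q\<^sup>2) r \<noteq> 0" "\<And>r. qpoch (1 / u) (q\<^sup>2) r \<noteq> 0"
    and "\<And>r. qpoch (v / q) (q\<^sup>2) r \<noteq> 0" "\<And>r. qpoch (1 / v) (q\<^sup>2) r \<noteq> 0"
    and "r \<ge> 1"
  shows "- (q powi (2 * (int r)\<^sup>2 - 4 * int r + 1) * F_seq d e u v q r)
    = coeff d e q (2 * r - 1) * K_weight u v q (2 * r - 1)"
proof -
  define D where "D = qpochs [d / q, e / q] (q\<^sup>2) r / (qpochs [q\<^sup>2 / d, q\<^sup>2 / e] (q\<^sup>2) r * (d * e) ^ r)"
  have sh: "q * u = u / q * q\<^sup>2" "q * v = v / q * q\<^sup>2" "q\<^sup>2 / u = 1 / u * q\<^sup>2" "q\<^sup>2 / v = 1 / v * q\<^sup>2"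
    using q_nonzero by (simp_all add: power2_eq_square)
  have rat: "qpoch (x * q\<^sup>2) (q\<^sup>2) r / qpoch x (q\<^sup>2) r = (1 - x * q ^ (2 * r)) / (1 - x)"
    if "x \<in> {u / q, v / q, 1 / u, 1 / v}" for x
    using that assms q_nonzero by (intro qpoch_ratio) auto
  have "F_seq d e u v q r = D
      * (qpoch (u / q * q\<^sup>2) (q\<^sup>2) r / qpoch (u / q) (q\<^sup>2) r * (qpoch (1 / u * q\<^sup>2) (q\<^sup>2) r / qpoch (1 / u) (q\<^sup>2) r))
      * (qpoch (v / q * q\<^sup>2) (q\<^sup>2) r / qpoch (v / q) (q\<^sup>2) r * (qpoch (1 / v * q\<^sup>2) (q\<^sup>2) r / qpoch (1 / v) (q\<^sup>2) r))"
    unfolding F_seq_def D_def qpochs_def list.map prod_list.Cons prod_list.Nil sh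
    by (simp only: times_divide_times_eq mult_1_right mult_ac)
  also have "\<dots> = D * (q ^ (2 * r) * q ^ (2 * r)) * K_weight u v q (2 * r - 1)"
  proof -
    have rats: "qpoch (w / q * q\<^sup>2) (q\<^sup>2) r / qpoch (w / q) (q\<^sup>2) r
        * (qpoch (1 / w * q\<^sup>2) (q\<^sup>2) r / qpoch (1 / w) (q\<^sup>2) r)
        = q ^ (2 * r) * ((w\<^sup>2 + q - w * node q (2 * r - 1)) / ((1 - w) * (q - w)))"
      if "w \<in> {u, v}" for w
    proof -
      have w: "w / q \<in> {u / q, v / q, 1 / u, 1 / v}" "1 / w \<in> {u / q, v / q, 1 / u, 1 / v}"
        and "w \<noteq> 0" "w \<noteq> 1"
        using that assms(1,2,4,5) by auto
      then show ?thesis unfolding w[THEN rat] using assms(11) by (intro odd_node_factor)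
    qed
    show ?thesis
      unfolding rats[of u, OF insertI1] rats[of v, OF insertI2[OF singletonI]] K_weight_def
      by (simp add: mult_ac)
  qed
  finally have F: "F_seq d e u v q r = \<dots>" .
  have "q powi (2 * (int r)\<^sup>2 - 4 * int r + 1) * (q ^ (2 * r) * q ^ (2 * r)) = q ^ (2 * r\<^sup>2 + 1)"
    using q_nonzero unfolding power_int_of_nat[symmetric] by (simp flip: power_int_add)
      (simp add: add.commute)
  moreover have "coeff d e q (2 * r - 1) = - odd_coeff d e q r"
    using assms(11) by (cases r) (simp_all add: coeff_def)
  ultimately show ?thesis
    unfolding F by (simp add: odd_coeff_def D_def mult_ac)
qed

end

section \<open>Assembly of the three Bailey pairs\<close>

lemma bailey_pair_beta_0: "bailey_pair q a \<alpha> \<beta> \<Longrightarrow> \<beta> 0 = 1"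
  by (simp add: bailey_pair_def)

theorem theorem2p11:
  fixes d e u v q :: complex
  assumes "d \<noteq> 0" and "e \<noteq> 0" and "u \<noteq> 0" and "v \<noteq> 0" and "q \<noteq> 0"
    and "\<And>n::nat. n \<ge> 1 \<Longrightarrow> q ^ n \<noteq> 1"
    and "\<And>r. qpochs [q^3 / d, q^3 / e, u, v, q / u, q / v] (q\<^sup>2) r \<noteq> 0"
    and "\<And>r. qpochs [q^2 / d, q^2 / e, u / q, v / q, 1 / u, 1 / v] (q\<^sup>2) r \<noteq> 0"
    and "\<And>n. qpochs [q^2 / d, q^2 / e] q n \<noteq> 0"
    and "\<And>n. K_den q (q powi (- int n)) (q powi (1 - int n)) d e u v (q\<^sup>2) \<noteq> 0"
  defines "E \<equiv> E_seq d e u v q"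
    and "F \<equiv> F_seq d e u v q"
  shows
    "(\<forall>\<alpha> \<beta>.
        (\<forall>r. \<alpha> (2 * r) =
           (1 - q ^ (4 * r + 1)) / (1 - q) * q powi (2 * (int r)\<^sup>2 - 2 * int r) * E r) \<and>
        (\<forall>r\<ge>1. \<alpha> (2 * r - 1) =
           - ((1 - q ^ (4 * r - 1)) / (1 - q) * q powi (2 * (int r)\<^sup>2 - 4 * int r + 1) * F r)) \<and>
        (\<forall>n. \<beta> n = K5 d e u v q n *
           (qpoch (q^3 / (d * e)) (q\<^sup>2) n /
             (qpoch (q\<^sup>2) (q\<^sup>2) n * qpochs [q^2 / d, q^2 / e] q n)))
        \<longrightarrow> bailey_pair q q \<alpha> \<beta> \<and> \<beta> 0 = 1) \<and>
     (\<forall>\<alpha> \<beta>.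
        \<alpha> 0 = 1 \<and>
        (\<forall>r\<ge>1. \<alpha> (2 * r) =
           q powi (2 * (int r)\<^sup>2 - 2 * int r) * E r + q powi (2 * (int r)\<^sup>2) * F r) \<and>
        (\<forall>r\<ge>1. \<alpha> (2 * r - 1) =
           - (q powi (2 * (int r)\<^sup>2 - 2 * int r + 1) * E (r - 1))
           - q powi (2 * (int r)\<^sup>2 - 4 * int r + 1) * F r) \<and>
        (\<forall>n. \<beta> n = K5 d e u v q n *
           (qpoch (q^3 / (d * e)) (q\<^sup>2) n /
             (qpoch (q\<^sup>2) (q\<^sup>2) n * qpochs [q^2 / d, q^2 / e] q n)))
        \<longrightarrow> bailey_pair q 1 \<alpha> \<beta> \<and> \<beta> 0 = 1) \<and>
     (\<forall>\<alpha> \<beta>.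
        \<alpha> 0 = 1 \<and>
        (\<forall>r\<ge>1. \<alpha> (2 * r) =
           q powi (2 * (int r)\<^sup>2) * E r + q powi (2 * (int r)\<^sup>2 - 2 * int r) * F r) \<and>
        (\<forall>r\<ge>1. \<alpha> (2 * r - 1) =
           - (q powi (2 * (int r)\<^sup>2 - 4 * int r + 2) * E (r - 1))
           - q powi (2 * (int r)\<^sup>2 - 2 * int r) * F r) \<and>
        (\<forall>n. \<beta> n = K5 d e u v q n *
           (q ^ n * qpoch (q^3 / (d * e)) (q\<^sup>2) n /
             (qpoch (q\<^sup>2) (q\<^sup>2) n * qpochs [q^2 / d, q^2 / e] q n)))
        \<longrightarrow> bailey_pair q 1 \<alpha> \<beta> \<and> \<beta> 0 = 1)"
proof -
  have u: "qpoch u (q\<^sup>2) r \<noteq> 0" "qpoch (q / u) (q\<^sup>2) r \<noteq> 0" "qpoch (u / q) (q\<^sup>2) r \<noteq> 0"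
      "qpoch (1 / u) (q\<^sup>2) r \<noteq> 0"
    and v: "qpoch v (q\<^sup>2) r \<noteq> 0" "qpoch (q / v) (q\<^sup>2) r \<noteq> 0" "qpoch (v / q) (q\<^sup>2) r \<noteq> 0"
      "qpoch (1 / v) (q\<^sup>2) r \<noteq> 0" for r
    using assms(7,8)[of r] by (simp_all add: qpochs_def)
  have de: "qpoch (q\<^sup>2 / d) q n \<noteq> 0" "qpoch (q\<^sup>2 / e) q n \<noteq> 0" for n
    using assms(9)[of n] by (simp_all add: qpochs_def)
  have uv: "u \<noteq> 1" "u \<noteq> q" "v \<noteq> 1" "v \<noteq> q"
    using assms(10)[of 0] by (auto simp: K_den_def)
  interpret bailey_parameters q d e
  proof
    fix n
    show "d \<noteq> q ^ (n + 2)" "e \<noteq> q ^ (n + 2)"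
      using qpoch_nonzero_factor[OF de(1), of n] qpoch_nonzero_factor[OF de(2), of n] assms(1,2)
      by (auto simp: power_add power2_eq_square field_simps)
    show "q * (d * e) \<noteq> q ^ (2 * n)"
    proof
      assume eq: "q * (d * e) = q ^ (2 * n)"
      \<comment> \<open>This is bcde in K. If it equals 1, the factor a^2 - bcde p of the
        denominator vanishes, because a^2 = p = q^2.\<close>
      have "q powi (- int n) * q powi (1 - int n) * d * e = q * (d * e) / q ^ (2 * n)"
        using assms(5) by (simp add: power_int_minus power_int_diff mult_2 power_add divide_inverse)
      also have "\<dots> = 1" unfolding eq using assms(5) by simp
      finally show False
        using assms(10)[of n] by (simp add: K_den_def)
    qed
  qed (use assms in auto)
  \<comment> \<open>All three parts are read off from this sequence, which is
    \<open>\<alpha>\<close> of (i) without (1 - q^(2j+1)) / (1 - q).\<close>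
  define A where "A j = coeff d e q j * K_weight u v q j" for j
  define \<beta>0 where "\<beta>0 n = K5 d e u v q n * moment d e q 0 n" for n
  have Aeven: "A (2 * r) = q powi (2 * (int r)\<^sup>2 - 2 * int r) * E r" for r
    unfolding A_def E_def using E_seq_eq_coeff u v uv assms(3,4) by simp
  have Aodd: "A (2 * r - 1) = - (q powi (2 * (int r)\<^sup>2 - 4 * int r + 1) * F r)" if "r \<ge> 1" for r
    unfolding A_def F_def using F_seq_eq_coeff u v uv assms(3,4) that by simp
  have pair: "bailey_pair q q (\<lambda>j. (1 - q ^ (2 * j + 1)) / (1 - q) * A j) \<beta>0"
    unfolding A_def \<beta>0_def using uv by (rule bailey_pair_K_weight)
  have parity: "P j" if "\<And>r. P (2 * r)" "\<And>r. r \<ge> 1 \<Longrightarrow> P (2 * r - 1)" for P and j :: nat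
    using that(1)[of "j div 2"] that(2)[of "(j + 1) div 2"]
    by (cases "even j") (auto elim: oddE)
  \<comment> \<open>Even indices are written 2(r - 1), so that their successor is the index 2r - 1
    used in (ii) and (iii).\<close>
  have parity_Suc: "P j"
    if "\<And>r. r \<ge> 1 \<Longrightarrow> P (2 * r - 1)" "\<And>r. r \<ge> 1 \<Longrightarrow> P (2 * (r - 1))" for P and j :: nat
  proof (rule parity)
    show "P (2 * r)" for r using that(2)[of "Suc r"] by simp
  qed (rule that(1))
  \<comment> \<open>Integer exponents are kept because 2r^2 - 4r + 1 equals -1 at r = 1.\<close>
  have pow: "q ^ m * (q powi k * x) = q powi (int m + k) * x" for m k x
    using assms(5) by (simp add: power_int_add)
  have i: "bailey_pair q q \<alpha> \<beta>"
    if ev: "\<forall>r. \<alpha> (2 * r) =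
           (1 - q ^ (4 * r + 1)) / (1 - q) * q powi (2 * (int r)\<^sup>2 - 2 * int r) * E r"
      and od: "\<forall>r\<ge>1. \<alpha> (2 * r - 1) =
           - ((1 - q ^ (4 * r - 1)) / (1 - q) * q powi (2 * (int r)\<^sup>2 - 4 * int r + 1) * F r)"
      and \<beta>: "\<forall>n. \<beta> n = K5 d e u v q n *
           (qpoch (q^3 / (d * e)) (q\<^sup>2) n /
             (qpoch (q\<^sup>2) (q\<^sup>2) n * qpochs [q^2 / d, q^2 / e] q n))" for \<alpha> \<beta>
  proof -
    have "\<alpha> j = (1 - q ^ (2 * j + 1)) / (1 - q) * A j" for j
    proof (induction j rule: parity)
      fix r
      show "\<alpha> (2 * r) = (1 - q ^ (2 * (2 * r) + 1)) / (1 - q) * A (2 * r)"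
        using ev by (simp add: Aeven)
    next
      fix r :: nat assume r: "r \<ge> 1"
      then have "2 * (2 * r - 1) + 1 = 4 * r - 1" by simp
      then show "\<alpha> (2 * r - 1) = (1 - q ^ (2 * (2 * r - 1) + 1)) / (1 - q) * A (2 * r - 1)"
        using od r by (simp only: Aodd) (simp add: mult_ac)
    qed
    moreover have "\<beta> = \<beta>0"
      using \<beta> by (auto simp: \<beta>0_def moment_0)
    ultimately show ?thesis using pair by presburger
  qed
  have ii: "bailey_pair q 1 \<alpha> \<beta>"
    if "\<alpha> 0 = 1"
      and ev: "\<forall>r\<ge>1. \<alpha> (2 * r) =
           q powi (2 * (int r)\<^sup>2 - 2 * int r) * E r + q powi (2 * (int r)\<^sup>2) * F r"
      and od: "\<forall>r\<ge>1. \<alpha> (2 * r - 1) =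
           - (q powi (2 * (int r)\<^sup>2 - 2 * int r + 1) * E (r - 1))
           - q powi (2 * (int r)\<^sup>2 - 4 * int r + 1) * F r"
      and \<beta>: "\<forall>n. \<beta> n = K5 d e u v q n *
           (qpoch (q^3 / (d * e)) (q\<^sup>2) n /
             (qpoch (q\<^sup>2) (q\<^sup>2) n * qpochs [q^2 / d, q^2 / e] q n))" for \<alpha> \<beta>
  proof -
    \<comment> \<open>For j = 2r - 1 the factor q^(4r-1) raises the exponent of F_r to 2r^2. For j =
      2r - 2 the factor q^(4r-3) raises that of E_(r-1) to 2r^2 - 2r + 1.\<close>
    have "\<alpha> (Suc j) = A (Suc j) - q ^ (2 * j + 1) * A j" for j
    proof (induction j rule: parity_Suc)
      fix r :: nat assume r: "r \<ge> 1"
      have "Suc (2 * r - 1) = 2 * r" "int (2 * (2 * r - 1) + 1) = 4 * int r - 1"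
        using r by auto
      then show "\<alpha> (Suc (2 * r - 1))
          = A (Suc (2 * r - 1)) - q ^ (2 * (2 * r - 1) + 1) * A (2 * r - 1)"
        using ev r by (simp only: Aodd Aeven mult_minus_right pow) simp
    next
      fix r :: nat assume r: "r \<ge> 1"
      have "Suc (2 * (r - 1)) = 2 * r - 1" "int (2 * (2 * (r - 1)) + 1) = 4 * int r - 3"
        "int (r - 1) = int r - 1"
        using r by auto
      then show "\<alpha> (Suc (2 * (r - 1)))
          = A (Suc (2 * (r - 1))) - q ^ (2 * (2 * (r - 1)) + 1) * A (2 * (r - 1))"
        using od r by (simp only: Aodd Aeven pow)
          (simp add: power2_eq_square algebra_simps)
    qed
    moreover have "\<beta> = \<beta>0"
      using \<beta> by (auto simp: \<beta>0_def moment_0)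
    ultimately show ?thesis
      using bailey_pair_q_to_one[OF pair refl] \<open>\<alpha> 0 = 1\<close> by simp
  qed
  have iii: "bailey_pair q 1 \<alpha> \<beta>"
    if "\<alpha> 0 = 1"
      and ev: "\<forall>r\<ge>1. \<alpha> (2 * r) =
           q powi (2 * (int r)\<^sup>2) * E r + q powi (2 * (int r)\<^sup>2 - 2 * int r) * F r"
      and od: "\<forall>r\<ge>1. \<alpha> (2 * r - 1) =
           - (q powi (2 * (int r)\<^sup>2 - 4 * int r + 2) * E (r - 1))
           - q powi (2 * (int r)\<^sup>2 - 2 * int r) * F r"
      and \<beta>: "\<forall>n. \<beta> n = K5 d e u v q n *
           (q ^ n * qpoch (q^3 / (d * e)) (q\<^sup>2) n /
             (qpoch (q\<^sup>2) (q\<^sup>2) n * qpochs [q^2 / d, q^2 / e] q n))" for \<alpha> \<beta>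
  proof -
    \<comment> \<open>For j = 2r - 1 the exponents of E_r and F_r become 2r^2 and 2r^2 - 2r. For j =
      2r - 2 those of F_r and E_(r-1) become 2r^2 - 2r and 2r^2 - 4r + 2.\<close>
    have "\<alpha> (Suc j) = q ^ Suc j * A (Suc j) - q ^ j * A j" for j
    proof (induction j rule: parity_Suc)
      fix r :: nat assume r: "r \<ge> 1"
      have "Suc (2 * r - 1) = 2 * r" "int (2 * r - 1) = 2 * int r - 1" "int (2 * r) = 2 * int r"
        using r by auto
      then show "\<alpha> (Suc (2 * r - 1))
          = q ^ Suc (2 * r - 1) * A (Suc (2 * r - 1)) - q ^ (2 * r - 1) * A (2 * r - 1)"
        using ev r by (simp only: Aodd Aeven mult_minus_right pow) simp
    next
      fix r :: nat assume r: "r \<ge> 1"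
      have "Suc (2 * (r - 1)) = 2 * r - 1" "int (2 * r - 1) = 2 * int r - 1"
        "int (2 * (r - 1)) = 2 * int r - 2" "int (r - 1) = int r - 1"
        using r by auto
      then show "\<alpha> (Suc (2 * (r - 1)))
          = q ^ Suc (2 * (r - 1)) * A (Suc (2 * (r - 1))) - q ^ (2 * (r - 1)) * A (2 * (r - 1))"
        using od r by (simp only: Aodd Aeven mult_minus_right pow)
          (simp add: power2_eq_square algebra_simps)
    qed
    moreover have "\<beta> = (\<lambda>n. q ^ n * \<beta>0 n)"
      using \<beta> by (auto simp: \<beta>0_def moment_0)
    ultimately show ?thesis
      using bailey_pair_q_to_one_power[OF pair refl] \<open>\<alpha> 0 = 1\<close> by simp
  qed
  show ?thesis
    using i ii iii bailey_pair_beta_0 by (intro conjI allI impI; elim conjE) metis+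
qed

end
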